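(* Suppose that: (1) $V$ has a global minimum at $0$, $V(0)=0$ and $V(\mathsf{x})\ge 0$ for all $\mathsf{x}\in\mathbb{R}^d$; (2) $L:=\sup\|\nabla^2V\|<\infty$; (3) there exist $K\in(0,\infty)$ and $R\in[0,\infty)$ such that $(\mathsf{x}-\mathsf{y})\cdot(\nabla V(\mathsf{x})-\nabla V(\mathsf{y}))\ge K|\mathsf{x}-\mathsf{y}|^2$ for all $\mathsf{x},\mathsf{y}\in\mathbb{R}^d$ with $|\mathsf{x}-\mathsf{y}|\ge R$; (4) $\tilde L:=\sup\|\nabla^2W\|<\infty$. Let $T\in(0,\infty)$, and let $\tilde R:=8R\sqrt{(L+K)/K}$, $\gamma:=\min(T^{-1},\tilde R^{-1}/4)$, $R_1:=\frac54(\tilde R+2T)$ and $f(r):=\int_0^r\exp(-\min(R_1,s)/T)\,\mathrm{d}s$ for $r\ge 0$. Let $\rho(x,y):=\sum_{i=1}^nf(|x^i-y^i|)$ for $x,y\in\mathbb{R}^{dn}$. Let $h_1\in[0,\infty)$ and suppose $$L(T+h_1)^2\le\frac35\min\Big(\frac14,\frac{3K}{10L},\frac{3}{256\cdot5L\tilde R^2}\Big),\qquad h_1\le\frac{KT}{525L+235K}.$$ Let $\epsilon\in[0,\infty)$ satisfy $$\epsilon\tilde L<\min\Big(\frac K6,\ \frac12\Big(\frac{K(\tilde R+T)}{36\cdot149}\Big)^2\exp\Big(-5\frac{\tilde R}{T}\Big)\Big).$$ Then for all $x,y\in\mathbb{R}^{dn}$ and for any $h\in[0,h_1]$ such that $h=0$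 or $T/h\in\mathbb{N}$, the coupling $(\mathbf{X}(x,y),\mathbf{Y}(x,y))$ of the unadjusted HMC transition steps with discretization step $h$ satisfies $$\mathbb{E}\big[\rho(\mathbf{X}(x,y),\mathbf{Y}(x,y))\big]\le(1-c)\,\rho(x,y),\qquad c=\frac1{156}KT^2\exp\Big(-\frac{5\tilde R}{4T}\Big).$$
   Context: Setting. Let $n,d\ge1$ be integers. Points of $\mathbb{R}^{dn}$ are written $x=(x^1,\dots,x^n)$ with $x^i\in\mathbb{R}^d$; $|\cdot|$ is the Euclidean norm and $\|\cdot\|$ the operator norm. $V,W:\mathbb{R}^d\to\mathbb{R}$ are twice continuously differentiable, $\epsilon\in[0,\infty)$, and $$U(x)=\sum_{i=1}^n\Big(V(x^i)+\frac{\epsilon}{n}\sum_{j\ne i}W(x^i-x^j)\Big),\qquad \int_{\mathbb{R}^{dn}}\exp(-U(x))\,\mathrm{d}x<\infty.$$ $\nabla_iU(x)=\nabla V(x^i)+\frac{\epsilon}{n}\sum_{j\neq i}\big(\nabla W(x^i-x^j)-\nabla W(x^j-x^i)\big)\in\mathbb{R}^d$ is the gradient of $U$ with respect to $x^i$. Dynamics. For $h>0$ put $\lfloor t\rfloor_h=\max\{s\in h\mathbb{Z}:s\le t\}$, $\lceil t\rceil_h=\min\{s\in h\mathbb{Z}:s\ge t\}$. The flow $(q_t(x,v),p_t(x,v))$ (interpolated velocity Verlet) is the solution of $$\frac{\mathrm{d}}{\mathrm{d}t}q^i_t=p^i_{\lfloor t\rfloor_h}-\frac h2\nabla_iU(q_{\lfloor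 t\rfloor_h}),\qquad\frac{\mathrm{d}}{\mathrm{d}t}p^i_t=-\frac12\big(\nabla_iU(q_{\lfloor t\rfloor_h})+\nabla_iU(q_{\lceil t\rceil_h})\big),\quad i=1,\dots,n,$$ with $(q_0,p_0)=(x,v)$. For $h=0$, it is the exact Hamiltonian flow $\frac{\mathrm{d}}{\mathrm{d}t}q^i_t=p^i_t$, $\frac{\mathrm{d}}{\mathrm{d}t}p^i_t=-\nabla_iU(q_t)$. The unadjusted HMC transition step with duration $T$ (with $T/h\in\mathbb{N}$ if $h>0$) is $x\mapsto q_T(x,\xi)$ with $\xi\sim\mathcal{N}(0,I_{dn})$. Coupling. For $x,y\in\mathbb{R}^{dn}$ set $\mathbf{X}(x,y)=q_T(x,\xi)$ and $\mathbf{Y}(x,y)=q_T(y,\eta)$, where $\xi\sim\mathcal{N}(0,I_{dn})$ and $\eta$ is built as follows. Let $\mathcal{U}_1,\dots,\mathcal{U}_n$ be independent $\mathrm{Unif}[0,1]$ random variables, independent of $\xi$. Put $z^i=x^i-y^i$, $e^i=z^i/|z^i|$ if $z^i\ne0$ and $e^i$ an arbitrary unit vector if $z^i=0$. If $|x^i-y^i|\ge\tilde R$, set $\eta^i=\xi^i$. If $|x^i-y^i|<\tilde R$, set $$\eta^i=\begin{cases}\xi^i+\gamma z^i&\text{if }\mathcal{U}_i\le\frac{\varphi_{0,1}(e^i\cdot\xi^i+\gamma|z^i|)}{\varphi_{0,1}(e^i\cdot\xi^i)},\\ \xi^i-2(e^i\cdot\xi^i)e^i&\text{otherwise,}\end{cases}$$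 where $\varphi_{0,1}$ is the standard normal density on $\mathbb{R}$. When $R=0$ (so $\tilde R=0$) the convention $1/0=+\infty$ is used. *)

theory Defs
  imports "HOL-Probability.Probability"
begin

definition grad :: "('a::real_inner \<Rightarrow> real) \<Rightarrow> 'a \<Rightarrow> 'a" where
  "grad f x = (THE D. GDERIV f x :> D)"

(* The derivative of the gradient, as an element of the type of bounded linear maps, whose norm
   is the operator norm. *)
definition hessian :: "('a::euclidean_space \<Rightarrow> real) \<Rightarrow> 'a \<Rightarrow> 'a \<Rightarrow>\<^sub>L 'a" where
  "hessian f x = Blinfun (frechet_derivative (grad f) (at x))"

definition C2 :: "('a::euclidean_space \<Rightarrow> real) \<Rightarrow> bool" where
  "C2 f \<longleftrightarrow> (\<forall>x. f differentiable (at x)) \<and> (\<forall>x. grad f differentiable (at x)) \<and>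
     continuous_on UNIV (hessian f)"

definition mean_field_potential ::
  "(real^'d \<Rightarrow> real) \<Rightarrow> (real^'d \<Rightarrow> real) \<Rightarrow> real \<Rightarrow> real^'d^'n \<Rightarrow> real" where
  "mean_field_potential V W \<epsilon> x =
     (\<Sum>i\<in>UNIV. V (x $ i) + \<epsilon> / real CARD('n) * (\<Sum>j\<in>UNIV - {i}. W (x $ i - x $ j)))"

(* Gradient with respect to the i-th particle; see partial_grad_mean_field for its value. *)
definition partial_grad :: "(real^'d^'n \<Rightarrow> real) \<Rightarrow> 'n \<Rightarrow> real^'d^'n \<Rightarrow> real^'d" where
  "partial_grad U i x = grad (\<lambda>z. U (\<chi> j. if j = i then z else x $ j)) (x $ i)"

(* For h > 0: the largest element of h\<int> that is \<le> t, and the smallest one that is \<ge> t. *)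
definition grid_floor :: "real \<Rightarrow> real \<Rightarrow> real" where
  "grid_floor h t = h * of_int \<lfloor>t / h\<rfloor>"

definition grid_ceiling :: "real \<Rightarrow> real \<Rightarrow> real" where
  "grid_ceiling h t = h * of_int \<lceil>t / h\<rceil>"

(* For h = 0 this is the Hamiltonian flow. For h > 0 the right-hand sides jump at the points of
   h\<int>, where the trajectory has kinks; as usual, a solution is then a continuous
   trajectory satisfying the equations away from these points. *)
definition hmc_solution ::
  "(real^'d^'n \<Rightarrow> real) \<Rightarrow> real \<Rightarrow> real^'d^'n \<Rightarrow> real^'d^'n \<Rightarrow>
   (real \<Rightarrow> real^'d^'n) \<Rightarrow> (real \<Rightarrow> real^'d^'n) \<Rightarrow> bool" where
  "hmc_solution U h x v q p \<longleftrightarrow>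
     q 0 = x \<and> p 0 = v \<and> continuous_on {0..} q \<and> continuous_on {0..} p \<and>
     (if h = 0
      then \<forall>t\<ge>0. \<forall>i.
        ((\<lambda>s. q s $ i) has_vector_derivative p t $ i) (at t within {0..}) \<and>
        ((\<lambda>s. p s $ i) has_vector_derivative - partial_grad U i (q t)) (at t within {0..})
      else \<forall>t>0. t \<notin> range (\<lambda>k::int. h * of_int k) \<longrightarrow> (\<forall>i.
        ((\<lambda>s. q s $ i) has_vector_derivative
           p (grid_floor h t) $ i - (h / 2) *\<^sub>R partial_grad U i (q (grid_floor h t))) (at t) \<and>
        ((\<lambda>s. p s $ i) has_vector_derivative
           - (1 / 2) *\<^sub>R (partial_grad U i (q (grid_floor h t))
                        + partial_grad U i (q (grid_ceiling h t)))) (at t)))"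

definition hmc_position ::
  "(real^'d^'n \<Rightarrow> real) \<Rightarrow> real \<Rightarrow> real \<Rightarrow> real^'d^'n \<Rightarrow> real^'d^'n \<Rightarrow> real^'d^'n" where
  "hmc_position U h t x v = (THE y. \<exists>q p. hmc_solution U h x v q p \<and> q t = y)"

(* \<xi> is the initial velocity of the chain at x, u the values of the uniform variables, e the chosen
   directions; the result is the initial velocity of the chain at y. *)
definition coupled_velocity ::
  "real \<Rightarrow> real \<Rightarrow> ('n \<Rightarrow> real^'d) \<Rightarrow> real^'d^'n \<Rightarrow> real^'d^'n \<Rightarrow> ('n \<Rightarrow> real) \<Rightarrow>
   real^'d^'n \<Rightarrow> real^'d^'n" where
  "coupled_velocity \<gamma> Rt e x y u \<xi> = (\<chi> i.
     if norm (x $ i - y $ i) \<ge> Rt then \<xi> $ i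
     else if u i \<le> std_normal_density (e i \<bullet> \<xi> $ i + \<gamma> * norm (x $ i - y $ i))
                   / std_normal_density (e i \<bullet> \<xi> $ i)
     then \<xi> $ i + \<gamma> *\<^sub>R (x $ i - y $ i)
     else \<xi> $ i - (2 * (e i \<bullet> \<xi> $ i)) *\<^sub>R e i)"

definition dist_fun :: "real \<Rightarrow> real \<Rightarrow> real \<Rightarrow> real" where
  "dist_fun R1 T r = integral {0..r} (\<lambda>s. exp (- min R1 s / T))"

definition particle_dist :: "real \<Rightarrow> real \<Rightarrow> real^'d^'n \<Rightarrow> real^'d^'n \<Rightarrow> real" where
  "particle_dist R1 T x y = (\<Sum>i\<in>UNIV. dist_fun R1 T (norm (x $ i - y $ i)))"


lemma grad_eqI:
  assumes "GDERIV f x :> D"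
  shows "grad f x = D"
  unfolding grad_def
proof (rule the_equality)
  show "GDERIV f x :> D" by (rule assms)
next
  fix D' assume "GDERIV f x :> D'"
  then have "(\<lambda>h. h \<bullet> D') = (\<lambda>h. h \<bullet> D)"
    using assms unfolding gderiv_def by (rule has_derivative_unique)
  then have "(D' - D) \<bullet> D' = (D' - D) \<bullet> D" by metis
  then have "(D' - D) \<bullet> (D' - D) = 0" by (simp add: inner_diff_right)
  then show "D' = D" by simp
qed

lemma gderiv_grad:
  fixes f :: "'a::euclidean_space \<Rightarrow> real"
  assumes "f differentiable (at x)"
  shows "GDERIV f x :> grad f x"
proof -
  obtain F where F: "(f has_derivative F) (at x)"
    using assms unfolding differentiable_def by blast
  then interpret F: bounded_linear F by (rule has_derivative_bounded_linear)
  define D where "D = (\<Sum>b\<in>Basis. F b *\<^sub>R b)"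
  have "F h = h \<bullet> D" for h
  proof -
    have "F h = F (\<Sum>b\<in>Basis. (h \<bullet> b) *\<^sub>R b)" by (simp add: euclidean_representation)
    also have "\<dots> = (\<Sum>b\<in>Basis. (h \<bullet> b) * F b)" by (simp add: F.sum F.scaleR)
    also have "\<dots> = h \<bullet> D" by (simp add: D_def inner_sum_right mult.commute)
    finally show ?thesis .
  qed
  then have "F = (\<lambda>h. h \<bullet> D)" by blast
  with F have "GDERIV f x :> D" by (simp add: gderiv_def)
  with grad_eqI show ?thesis by metis
qed

lemma partial_grad_mean_field:
  fixes V W :: "real^'d \<Rightarrow> real" and x :: "real^'d^'n"
  assumes "C2 V" "C2 W"
  shows "partial_grad (mean_field_potential V W \<epsilon>) i x =
    grad V (x $ i) + (\<epsilon> / real CARD('n)) *\<^sub>R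
      (\<Sum>j\<in>UNIV - {i}. grad W (x $ i - x $ j) - grad W (x $ j - x $ i))"
proof -
  define c where "c = \<epsilon> / real CARD('n)"
  have dV: "(V has_derivative (\<lambda>h. h \<bullet> grad V z)) (at z)" for z
    using gderiv_grad[of V z] assms by (simp add: C2_def gderiv_def)
  have dW: "(W has_derivative (\<lambda>h. h \<bullet> grad W z)) (at z)" for z
    using gderiv_grad[of W z] assms by (simp add: C2_def gderiv_def)
  have dW1: "((\<lambda>z. W (z - a)) has_derivative (\<lambda>h. h \<bullet> grad W (z - a))) (at z)" for z a
    by (rule has_derivative_compose[OF _ dW, of "\<lambda>z. z - a" "\<lambda>h. h", simplified])
       (auto intro!: derivative_eq_intros)
  have dW2: "((\<lambda>z. W (a - z)) has_derivative (\<lambda>h. - h \<bullet> grad W (a - z))) (at z)" for z a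
    by (rule has_derivative_compose[OF _ dW, of "\<lambda>z. a - z" "\<lambda>h. - h"])
       (auto intro!: derivative_eq_intros)
  define K where "K = (\<Sum>k\<in>UNIV - {i}. V (x $ k) + c * (\<Sum>j\<in>UNIV - {i} - {k}. W (x $ k - x $ j)))"
  have eq: "mean_field_potential V W \<epsilon> (\<chi> j. if j = i then z else x $ j) =
     V z + c * (\<Sum>j\<in>UNIV - {i}. W (z - x $ j)) + (c * (\<Sum>k\<in>UNIV - {i}. W (x $ k - z)) + K)" for z
  proof -
    let ?x = "\<chi> j. if j = i then z else x $ j"
    have inner: "(\<Sum>j\<in>UNIV - {k}. W (?x $ k - ?x $ j)) =
       W (x $ k - z) + (\<Sum>j\<in>UNIV - {i} - {k}. W (x $ k - x $ j))" if "k \<noteq> i" for k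
    proof -
      have "(\<Sum>j\<in>UNIV - {k}. W (?x $ k - ?x $ j)) =
        W (?x $ k - ?x $ i) + (\<Sum>j\<in>UNIV - {k} - {i}. W (?x $ k - ?x $ j))"
        using that by (subst sum.remove[of _ i]) auto
      also have "(\<Sum>j\<in>UNIV - {k} - {i}. W (?x $ k - ?x $ j)) =
        (\<Sum>j\<in>UNIV - {i} - {k}. W (x $ k - x $ j))"
        using that by (intro sum.cong) auto
      finally show ?thesis using that by simp
    qed
    have "mean_field_potential V W \<epsilon> ?x =
       (V (?x $ i) + c * (\<Sum>j\<in>UNIV - {i}. W (?x $ i - ?x $ j))) +
       (\<Sum>k\<in>UNIV - {i}. V (?x $ k) + c * (\<Sum>j\<in>UNIV - {k}. W (?x $ k - ?x $ j)))"
      unfolding mean_field_potential_def c_def[symmetric]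
      by (subst sum.remove[of _ i]) auto
    also have "(\<Sum>k\<in>UNIV - {i}. V (?x $ k) + c * (\<Sum>j\<in>UNIV - {k}. W (?x $ k - ?x $ j))) =
       (\<Sum>k\<in>UNIV - {i}. c * W (x $ k - z) +
         (V (x $ k) + c * (\<Sum>j\<in>UNIV - {i} - {k}. W (x $ k - x $ j))))"
    proof (intro sum.cong refl)
      fix k assume "k \<in> UNIV - {i}"
      then have k: "k \<noteq> i" by simp
      show "V (?x $ k) + c * (\<Sum>j\<in>UNIV - {k}. W (?x $ k - ?x $ j)) =
        c * W (x $ k - z) + (V (x $ k) + c * (\<Sum>j\<in>UNIV - {i} - {k}. W (x $ k - x $ j)))"
        unfolding inner[OF k] using k by (simp add: distrib_left)
    qed
    also have "\<dots> = c * (\<Sum>k\<in>UNIV - {i}. W (x $ k - z)) + K"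
      by (simp add: sum.distrib K_def sum_distrib_left)
    also have "(\<Sum>j\<in>UNIV - {i}. W (?x $ i - ?x $ j)) = (\<Sum>j\<in>UNIV - {i}. W (z - x $ j))"
      by (intro sum.cong) auto
    finally show ?thesis by simp
  qed
  have "((\<lambda>z. V z + c * (\<Sum>j\<in>UNIV - {i}. W (z - x $ j)) +
        (c * (\<Sum>k\<in>UNIV - {i}. W (x $ k - z)) + K)) has_derivative
      (\<lambda>h. h \<bullet> grad V (x $ i) + c * (\<Sum>j\<in>UNIV - {i}. h \<bullet> grad W (x $ i - x $ j)) +
        (c * (\<Sum>k\<in>UNIV - {i}. - h \<bullet> grad W (x $ k - x $ i)) + 0))) (at (x $ i))"
    by (intro has_derivative_add has_derivative_mult_right has_derivative_sum dV dW1 dW2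
        has_derivative_const)
  also have "(\<lambda>h. h \<bullet> grad V (x $ i) + c * (\<Sum>j\<in>UNIV - {i}. h \<bullet> grad W (x $ i - x $ j)) +
        (c * (\<Sum>k\<in>UNIV - {i}. - h \<bullet> grad W (x $ k - x $ i)) + 0)) =
      (\<lambda>h. h \<bullet> (grad V (x $ i) + c *\<^sub>R
        (\<Sum>j\<in>UNIV - {i}. grad W (x $ i - x $ j) - grad W (x $ j - x $ i))))"
    by (simp add: fun_eq_iff inner_add_right inner_sum_right inner_diff_right sum_subtractf
        sum_negf right_diff_distrib)
  finally show ?thesis
    unfolding partial_grad_def eq c_def[symmetric] by (intro grad_eqI) (simp add: gderiv_def)
qed

end

theory Submission
  imports Defs
begin

text \<open>The proof follows the two copies of the system particle by particle and shows that the expected change of each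
summand of the distance is negative, up to an interaction error that is controlled after summing over all particles.

A difference \<open>z\<close> of two particle trajectories satisfies \<open>z t = z 0 + t w - G t\<close>, where \<open>w\<close> is the difference of the
initial velocities and \<open>G t\<close> is an average of force differences with total weight \<open>t\<^sup>2 / 2\<close>. This holds for the Hamiltonian
flow and, at grid times, for velocity Verlet with the same weight; \<open>accelerated_by\<close> captures it, and no
estimate below distinguishes the two cases. Since \<open>L T\<^sup>2 \<le> 3/20\<close>, the free motion \<open>z 0 + t w\<close>
dominates. There are three cases for a pair at initial distance \<open>r\<close>.

If \<open>r \<ge> Rt\<close>, then \<open>w = 0\<close> and the force pulls inwards; \<open>contraction_far\<close> gives
\<open>norm (z T) \<le> (1 - K T\<^sup>2 / 5) r\<close> up to the interaction.

If \<open>r < Rt\<close> and the shift is accepted, then \<open>w = - \<gamma> z 0\<close> and the free motion alone contracts by the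
factor \<open>1 - \<gamma> T\<close>; the forces perturb this by at most \<open>9/100 \<gamma> T r\<close>.

If \<open>r < Rt\<close> and the shift is rejected, the distance may grow to \<open>5/4 (r + 2 T s)\<close>, with \<open>s\<close> the size of the velocity
component along the difference. This has probability of order \<open>\<gamma> r\<close>, and the concave function
\<open>f = dist_fun R1 T\<close> limits the damage: growing from \<open>r\<close> to \<open>R1\<close> costs at most \<open>T f' r\<close>, and beyond \<open>R1\<close> the slope is only
\<open>exp (- R1 / T)\<close>. The expected cost is thus a multiple of \<open>\<gamma> T r f' r\<close>, as is the expected gain of the accepted
moves, and the normal moments in \<open>rejection_bounds\<close> make the gain win (\<open>drift_near\<close>).

The interaction adds to each distance an error whose sum over the particles is at most \<open>5 \<epsilon> Lt T\<^sup>2\<close> times the sum of the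
free excursions (\<open>trajectories_close\<close>). By \<open>weak_interaction_bound\<close> this is negligible against the
rate. Since \<open>f\<close> is 1-Lipschitz with \<open>f r \<le> r\<close>, the errors add up linearly, and a drift of \<open>- c r\<close> per particle suffices.

The position at time \<open>T\<close> is described as the unique endpoint of a solution. Uniqueness and continuous dependence on
the velocity come from the same comparison of trajectories; existence is Picard's contraction argument for the Hamiltonian
flow and linear interpolation for Verlet.\<close>

section \<open>Consequences of the bounds on the potential\<close>

lemma grad_lipschitz:
  fixes f :: "'a::euclidean_space \<Rightarrow> real"
  assumes "C2 f" and bdd: "bdd_above (range (\<lambda>a. norm (hessian f a)))"
  shows "norm (grad f a - grad f b) \<le> (SUP a. norm (hessian f a)) * norm (a - b)"
proof (rule differentiable_bound[of UNIV "grad f" "\<lambda>x. frechet_derivative (grad f) (at x)"])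
  fix x
  show der: "(grad f has_derivative frechet_derivative (grad f) (at x)) (at x within UNIV)"
    using assms(1) by (simp add: C2_def frechet_derivative_works)
  then have "blinfun_apply (hessian f x) = frechet_derivative (grad f) (at x)"
    unfolding hessian_def
    by (intro bounded_linear_Blinfun_apply has_derivative_bounded_linear) auto
  then have "onorm (frechet_derivative (grad f) (at x)) = norm (hessian f x)"
    by (simp add: norm_blinfun.rep_eq)
  also have "\<dots> \<le> (SUP a. norm (hessian f a))"
    by (intro cSUP_upper bdd) simp
  finally show "onorm (frechet_derivative (grad f) (at x)) \<le> (SUP a. norm (hessian f a))" .
qed auto

text \<open>At a difference vector of length at least \<open>R\<close>, the dissipativity constant is at most the Lipschitz constant. This keeps
\<open>K T\<^sup>2\<close> as small as \<open>L T\<^sup>2\<close>, although only the latter is bounded by the step-size condition.\<close>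

lemma dissipativity_le_lipschitz:
  fixes g :: "'a::euclidean_space \<Rightarrow> 'a"
  assumes lip: "\<And>a b. norm (g a - g b) \<le> L * norm (a - b)"
    and diss: "\<And>a b. R \<le> norm (a - b) \<Longrightarrow> K * (norm (a - b))\<^sup>2 \<le> (a - b) \<bullet> (g a - g b)"
  shows "K \<le> L"
proof -
  obtain a :: 'a where a: "norm a = max R 1"
    using vector_choose_size[of "max R 1"] by (meson max.coboundedI2 zero_le_one)
  have "K * (norm a)\<^sup>2 \<le> a \<bullet> (g a - g 0)" using diss[of a 0] a by simp
  also have "\<dots> \<le> norm a * norm (g a - g 0)" by (rule norm_cauchy_schwarz)
  also have "\<dots> \<le> norm a * (L * norm a)"
    using lip[of a 0] by (intro mult_left_mono) auto
  finally have "K * (norm a)\<^sup>2 \<le> L * (norm a)\<^sup>2" by (simp add: power2_eq_square ac_simps)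
  moreover have "0 < norm a" using a by (simp add: max_def)
  ultimately show ?thesis by simp
qed

section \<open>The motion of the difference of two trajectories\<close>

text \<open>The common feature of Newtonian motion with acceleration \<open>- F\<close> and of its velocity Verlet
discretization: the displacement \<open>z t - z 0 - t w\<close> is minus an average of values of \<open>F\<close> with total
weight \<open>t\<^sup>2 / 2\<close>. It is expressed by testing against vectors \<open>a\<close>, which mentions neither
integrals nor sums, so that all estimates below hold at once for continuous time, where \<open>I\<close> is an
interval, and for discrete time, where \<open>I\<close> is a grid.\<close>

definition accelerated_by ::
  "real set \<Rightarrow> (real \<Rightarrow> 'a::real_inner) \<Rightarrow> 'a \<Rightarrow> (real \<Rightarrow> 'a) \<Rightarrow> bool" where
  "accelerated_by I F w z \<longleftrightarrow>
     (\<forall>t\<in>I. \<forall>a m. (\<forall>s\<in>I. m \<le> a \<bullet> F s) \<longrightarrow>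
        a \<bullet> z t \<le> a \<bullet> z 0 + t * (a \<bullet> w) - m * t\<^sup>2 / 2)"

lemma accelerated_byD:
  assumes "accelerated_by I F w z" "t \<in> I" "\<And>s. s \<in> I \<Longrightarrow> m \<le> a \<bullet> F s"
  shows "a \<bullet> z t \<le> a \<bullet> z 0 + t * (a \<bullet> w) - m * t\<^sup>2 / 2"
  using assms unfolding accelerated_by_def by blast

text \<open>The displacement itself serves as the test vector.\<close>

lemma norm_deviation_le:
  assumes acc: "accelerated_by I F w z" and t: "t \<in> I" and F: "\<And>s. s \<in> I \<Longrightarrow> norm (F s) \<le> m"
  shows "norm (z t - z 0 - t *\<^sub>R w) \<le> m * t\<^sup>2 / 2"
proof -
  define d where "d = z t - z 0 - t *\<^sub>R w"
  have "- (norm d * m) \<le> d \<bullet> F s" if "s \<in> I" for s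
  proof -
    have "\<bar>d \<bullet> F s\<bar> \<le> norm d * norm (F s)" by (rule Cauchy_Schwarz_ineq2)
    also have "\<dots> \<le> norm d * m" by (intro mult_left_mono F that) auto
    finally show ?thesis by simp
  qed
  from accelerated_byD[OF acc t this]
  have "d \<bullet> d \<le> norm d * (m * t\<^sup>2 / 2)"
    by (simp add: d_def inner_diff_right algebra_simps)
  then have "norm d * norm d \<le> norm d * (m * t\<^sup>2 / 2)"
    by (simp add: dot_square_norm power2_eq_square)
  moreover have "0 \<le> m * t\<^sup>2 / 2"
    using order.trans[OF norm_ge_zero F[OF t]] by simp
  ultimately show ?thesis
    unfolding d_def[symmetric] by (cases "norm d = 0") auto
qed

text \<open>If the force grows at most linearly, up to an external perturbation of size \<open>B\<close>, then the largest
distance \<open>S\<close> reached obeys \<open>S \<le> Z + (L S + B) T\<^sup>2 / 2\<close>, where \<open>Z\<close> bounds the force-free motion.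
With \<open>L T\<^sup>2 / 2 \<le> 3/40\<close> this can be solved for \<open>S\<close>, and \<open>40/37 = 1 / (1 - 3/40)\<close>. Bounding the free motion by
\<open>Z\<close>, rather than by \<open>norm (z 0) + T * norm w\<close>, loses nothing when \<open>w\<close> points towards the origin, as it
does for an accepted coupling of the velocities.\<close>

lemma excursion_le:
  fixes z :: "real \<Rightarrow> 'a::real_inner"
  assumes acc: "accelerated_by I F w z" and I: "I \<subseteq> {0..T}" "0 \<in> I" "T \<in> I"
    and LT: "0 \<le> L" "L * T\<^sup>2 \<le> 3/20" and B: "0 \<le> B"
    and bdd: "bdd_above ((\<lambda>s. norm (z s)) ` I)" and S: "S = (SUP s\<in>I. norm (z s))"
    and F: "\<And>s. s \<in> I \<Longrightarrow> norm (F s) \<le> L * norm (z s) + B"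
    and Z: "\<And>t. t \<in> {0..T} \<Longrightarrow> norm (z 0 + t *\<^sub>R w) \<le> Z"
  shows "S \<le> 40/37 * (Z + B * T\<^sup>2 / 2)"
    and "\<And>s. s \<in> I \<Longrightarrow> norm (z s) \<le> S"
    and "\<And>s. s \<in> I \<Longrightarrow> norm (z s - z 0 - s *\<^sub>R w) \<le> (L * S + B) * T\<^sup>2 / 2"
    and "norm (z T) \<le> norm (z 0 + T *\<^sub>R w) + 20/37 * (L * T\<^sup>2) * Z + B * T\<^sup>2"
proof -
  show zS: "norm (z s) \<le> S" if "s \<in> I" for s
    unfolding S using that bdd by (rule cSUP_upper)
  then have S0: "0 \<le> S" using I norm_ge_zero order.trans by metis
  have FS: "norm (F s) \<le> L * S + B" if "s \<in> I" for s
    using F[OF that] mult_left_mono[OF zS[OF that] LT(1)] by linarith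
  show dev: "norm (z s - z 0 - s *\<^sub>R w) \<le> (L * S + B) * T\<^sup>2 / 2" if "s \<in> I" for s
  proof -
    have "norm (z s - z 0 - s *\<^sub>R w) \<le> (L * S + B) * s\<^sup>2 / 2"
      by (rule norm_deviation_le[OF acc that FS])
    also have "\<dots> \<le> (L * S + B) * T\<^sup>2 / 2"
      using that I S0 LT B by (intro divide_right_mono mult_left_mono power_mono) auto
    finally show ?thesis .
  qed
  have "norm (z s) \<le> Z + (L * S + B) * T\<^sup>2 / 2" if "s \<in> I" for s
  proof -
    have "norm (z s) \<le> norm (z 0 + s *\<^sub>R w) + norm (z s - z 0 - s *\<^sub>R w)"
      using norm_triangle_ineq[of "z 0 + s *\<^sub>R w" "z s - z 0 - s *\<^sub>R w"] by simp
    with Z[of s] dev[OF that] that I show ?thesis by auto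
  qed
  then have "S \<le> Z + (L * S + B) * T\<^sup>2 / 2"
    unfolding S using I(2) by (intro cSUP_least) auto
  moreover have LTS: "L * T\<^sup>2 * S \<le> 3/20 * S"
    using LT S0 by (intro mult_right_mono) auto
  ultimately show S_le: "S \<le> 40/37 * (Z + B * T\<^sup>2 / 2)"
    by (simp add: field_simps)
  have "L * T\<^sup>2 * S \<le> L * T\<^sup>2 * (40/37 * (Z + B * T\<^sup>2 / 2))"
    using S_le LT by (intro mult_left_mono) auto
  moreover have "L * T\<^sup>2 * (B * T\<^sup>2) \<le> 3/20 * (B * T\<^sup>2)"
    using LT B by (intro mult_right_mono) auto
  moreover have "norm (z T) \<le> norm (z 0 + T *\<^sub>R w) + norm (z T - z 0 - T *\<^sub>R w)"
    using norm_triangle_ineq[of "z 0 + T *\<^sub>R w" "z T - z 0 - T *\<^sub>R w"] by simp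
  moreover have "0 \<le> B * T\<^sup>2" using B by simp
  ultimately show "norm (z T) \<le> norm (z 0 + T *\<^sub>R w) + 20/37 * (L * T\<^sup>2) * Z + B * T\<^sup>2"
    using dev[OF I(3)] by (simp add: algebra_simps)
qed

text \<open>Contraction for a particle pair that is far apart and has equal initial velocities. Throughout the time
\<open>T\<close> the difference stays so close to \<open>z 0\<close> that the force, which pulls inwards along \<open>z s\<close>, also
pulls inwards along \<open>z 0\<close>, up to small multiples of \<open>K T\<^sup>2\<close> and \<open>(L T\<^sup>2)\<^sup>2\<close>; the condition \<open>L\<^sup>2 T\<^sup>2 \<le> 9/50 K\<close> makes
the latter a fraction of the gain, which is of size \<open>K T\<^sup>2\<close>. The part \<open>F1\<close> of the force comes from the
confining potential, the small part \<open>F2\<close> from the interaction with the other particles.\<close>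

lemma contraction_far:
  fixes z :: "real \<Rightarrow> 'a::real_inner"
  assumes acc: "accelerated_by I F 0 z" and I: "I \<subseteq> {0..T}" "0 \<in> I" "T \<in> I" and T: "0 < T"
    and L: "0 \<le> L" "L * T\<^sup>2 \<le> 3/20" "L\<^sup>2 * T\<^sup>2 \<le> 9/50 * K" and K: "0 < K" "K \<le> L"
    and B: "0 \<le> B"
    and bdd: "bdd_above ((\<lambda>s. norm (z s)) ` I)"
    and F: "\<And>s. s \<in> I \<Longrightarrow> F s = F1 s + F2 s"
    and F1: "\<And>s. s \<in> I \<Longrightarrow> norm (F1 s) \<le> L * norm (z s)"
    and mono: "\<And>s. s \<in> I \<Longrightarrow> K * (norm (z s))\<^sup>2 - K / 64 * (norm (z 0))\<^sup>2 \<le> z s \<bullet> F1 s"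
    and F2: "\<And>s. s \<in> I \<Longrightarrow> norm (F2 s) \<le> B"
  shows "norm (z T) \<le> (1 - K * T\<^sup>2 / 5) * norm (z 0) + B * T\<^sup>2"
proof -
  define r k b l where "r = norm (z 0)" and "k = K * T\<^sup>2" and "b = B * T\<^sup>2" and "l = L * T\<^sup>2"
  define S where "S = (SUP s\<in>I. norm (z s))"
  define q where "q = l * S"
  define D where "D = q / 2 + b / 2"
  have FLB: "norm (F s) \<le> L * norm (z s) + B" if "s \<in> I" for s
    using norm_triangle_ineq[of "F1 s" "F2 s"] F[OF that] F1[OF that] F2[OF that] by auto
  have Z: "norm (z 0 + t *\<^sub>R 0) \<le> r" for t by (simp add: r_def)
  have exc1: "S \<le> 40/37 * (r + B * T\<^sup>2 / 2)"
    using excursion_le(1)[OF acc I L(1,2) B bdd S_def FLB Z] .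
  have exc2: "norm (z s) \<le> S" if "s \<in> I" for s
    using excursion_le(2)[OF acc I L(1,2) B bdd S_def FLB Z that] .
  have exc3: "norm (z s - z 0 - s *\<^sub>R 0) \<le> (L * S + B) * T\<^sup>2 / 2" if "s \<in> I" for s
    using excursion_le(3)[OF acc I L(1,2) B bdd S_def FLB Z that] .
  have r0: "0 \<le> r" and k0: "0 < k" and b0: "0 \<le> b" and l0: "0 \<le> l"
    using K B L T by (auto simp: r_def k_def b_def l_def)
  have kl: "k \<le> l" unfolding k_def l_def by (intro mult_right_mono K) auto
  have l: "l \<le> 3/20" using L by (simp add: l_def)
  have "L\<^sup>2 * T\<^sup>2 * T\<^sup>2 \<le> 9/50 * K * T\<^sup>2" by (intro mult_right_mono L) auto
  then have l2: "l\<^sup>2 \<le> 9/50 * k"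
    by (simp add: l_def k_def power2_eq_square algebra_simps)
  have S: "S \<le> 40/37 * (r + b / 2)" using exc1 by (simp add: b_def)
  have S0: "0 \<le> S" using exc2[OF I(2)] order.trans[OF norm_ge_zero] by blast
  have S': "S \<le> 40/37 * (r + b)" using S b0 by simp
  have q0: "0 \<le> q" using l0 S0 by (simp add: q_def)
  have "q \<le> 3/20 * S" unfolding q_def by (intro mult_right_mono l S0)
  then have q: "q \<le> 6/37 * (r + b)" using S' by simp
  have q2: "q\<^sup>2 \<le> 211/1000 * k * (r + b)\<^sup>2"
  proof -
    have "q\<^sup>2 = l\<^sup>2 * S\<^sup>2" by (simp add: q_def power_mult_distrib)
    also have "\<dots> \<le> (9/50 * k) * (40/37 * (r + b))\<^sup>2"
      using l2 S' S0 k0 by (intro mult_mono power_mono) auto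
    also have "\<dots> = 9/50 * (40/37)\<^sup>2 * (k * (r + b)\<^sup>2)"
      by (simp only: power_mult_distrib mult_ac)
    also have "\<dots> \<le> 211/1000 * (k * (r + b)\<^sup>2)"
      using k0 by (intro mult_right_mono) (auto simp: power2_eq_square)
    finally show ?thesis by simp
  qed
  have kD: "0 \<le> D" using q0 b0 by (simp add: D_def)
  have dev: "norm (z s - z 0) \<le> D" if "s \<in> I" for s
    using exc3[OF that]
    by (simp add: r_def D_def q_def b_def l_def algebra_simps)
  have kle: "k \<le> 3/20" using kl l by simp
  have krb: "k * (r * b) \<le> 3/20 * (r * b)" and kbb: "k * (b * b) \<le> 3/20 * (b * b)"
    using kle r0 b0 by (intro mult_right_mono; simp)+
  have sq: "(r + b)\<^sup>2 = r * r + 2 * (r * b) + b * b" by (simp add: power2_eq_square algebra_simps)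
  have q2': "q\<^sup>2 \<le> 211/1000 * (k * (r * r)) + 64/1000 * (r * b) + 32/1000 * (b * b)"
  proof -
    have "q\<^sup>2 \<le> 211/1000 * (k * (r * r)) + 422/1000 * (k * (r * b)) + 211/1000 * (k * (b * b))"
      using q2 unfolding sq by (simp add: algebra_simps)
    moreover have "0 \<le> r * b" "0 \<le> b * b" using r0 b0 by auto
    ultimately show ?thesis using krb kbb by linarith
  qed
  \<comment> \<open>A lower bound for the component of the force along the initial difference: of the gain
    \<open>k r\<^sup>2\<close>, the errors proportional to \<open>k r\<^sup>2\<close> leave at least 7/10.\<close>
  define m where "m = (7/10 * (k * (r * r)) - 132/100 * (r * b) - 1/9 * (b * b)) / T\<^sup>2"
  have push: "m \<le> z 0 \<bullet> F s" if s: "s \<in> I" for s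
  proof -
    define d where "d = z s - z 0"
    have d: "norm d \<le> D" using dev[OF s] by (simp add: d_def)
    have rD: "r * norm d \<le> r * D" using d r0 by (rule mult_left_mono)
    have "\<bar>z 0 \<bullet> d\<bar> \<le> r * norm d" unfolding r_def by (rule Cauchy_Schwarz_ineq2)
    then have "r\<^sup>2 - 2 * (r * D) \<le> (norm (z s))\<^sup>2"
    proof -
      have "(norm (z s))\<^sup>2 = r\<^sup>2 + 2 * (z 0 \<bullet> d) + (norm d)\<^sup>2"
        unfolding r_def d_def by (simp add: power2_norm_eq_inner inner_diff inner_commute)
      moreover have "0 \<le> (norm d)\<^sup>2" by simp
      ultimately show ?thesis using \<open>\<bar>z 0 \<bullet> d\<bar> \<le> r * norm d\<close> rD by linarith
    qed
    then have a1: "k * (r\<^sup>2 - 2 * (r * D)) \<le> k * (norm (z s))\<^sup>2"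
      using k0 by (intro mult_left_mono) auto
    have nF1: "norm (F1 s) \<le> L * S"
      using F1[OF s] mult_left_mono[OF exc2[OF s] L(1)] by (simp add: r_def)
    have "\<bar>d \<bullet> F1 s\<bar> \<le> norm d * norm (F1 s)" by (rule Cauchy_Schwarz_ineq2)
    also have "\<dots> \<le> D * (L * S)" using d nF1 kD by (intro mult_mono) auto
    finally have a2: "d \<bullet> F1 s \<le> D * (L * S)" by simp
    have "\<bar>z 0 \<bullet> F2 s\<bar> \<le> r * norm (F2 s)" unfolding r_def by (rule Cauchy_Schwarz_ineq2)
    also have "\<dots> \<le> r * B" using F2[OF s] r0 by (intro mult_left_mono) auto
    finally have a3: "- (r * B) \<le> z 0 \<bullet> F2 s" by simp
    have "z 0 \<bullet> F s = z s \<bullet> F1 s - d \<bullet> F1 s + z 0 \<bullet> F2 s"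
      using F[OF s] by (simp add: d_def inner_diff_left inner_add_right)
    also have "\<dots> \<ge> (K * (norm (z s))\<^sup>2 - K / 64 * r\<^sup>2) - D * (L * S) - r * B"
      using mono[OF s] a2 a3 by (simp add: r_def)
    finally have "T\<^sup>2 * ((K * (norm (z s))\<^sup>2 - K / 64 * r\<^sup>2) - D * (L * S) - r * B) \<le> T\<^sup>2 * (z 0 \<bullet> F s)"
      by (intro mult_left_mono) auto
    then have "k * (norm (z s))\<^sup>2 - k / 64 * r\<^sup>2 - D * q - r * b \<le> T\<^sup>2 * (z 0 \<bullet> F s)"
      by (simp add: k_def q_def l_def b_def algebra_simps)
    with a1 have main: "k * (r\<^sup>2 - 2 * (r * D)) - k / 64 * r\<^sup>2 - D * q - r * b \<le> T\<^sup>2 * (z 0 \<bullet> F s)"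
      by linarith
    have Dq: "D * q \<le> 106/1000 * (k * (r * r)) + 114/1000 * (r * b) + 98/1000 * (b * b)"
    proof -
      have "D * q = q\<^sup>2 / 2 + b * q / 2" by (simp add: D_def power2_eq_square algebra_simps)
      moreover have "b * q \<le> b * (6/37 * (r + b))" by (intro mult_left_mono q b0)
      then have "b * q \<le> 6/37 * (r * b) + 6/37 * (b * b)"
        by (simp add: algebra_simps)
      moreover have "0 \<le> k * (r * r)" "0 \<le> r * b" "0 \<le> b * b" using k0 r0 b0 by auto
      ultimately show ?thesis using q2' by linarith
    qed
    have rDk: "2 * (k * (r * D)) \<le> 163/1000 * (k * (r * r)) + 18/100 * (r * b)"
    proof -
      have "r * q \<le> r * (6/37 * (r + b))" by (intro mult_left_mono q r0)
      then have "2 * (r * D) \<le> 6/37 * (r * r) + 43/37 * (r * b)"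
        by (simp add: D_def algebra_simps)
      then have "k * (2 * (r * D)) \<le> k * (6/37 * (r * r) + 43/37 * (r * b))"
        using k0 by (intro mult_left_mono) auto
      then have "2 * (k * (r * D)) \<le> 6/37 * (k * (r * r)) + 43/37 * (k * (r * b))"
        by (simp add: algebra_simps)
      moreover have "0 \<le> k * (r * r)" "0 \<le> r * b" using k0 r0 b0 by auto
      ultimately show ?thesis using krb by linarith
    qed
    have "k * (r\<^sup>2 - 2 * (r * D)) - k / 64 * r\<^sup>2 = 63/64 * (k * (r * r)) - 2 * (k * (r * D))"
      by (simp add: power2_eq_square algebra_simps)
    moreover have "T\<^sup>2 * m = 7/10 * (k * (r * r)) - 132/100 * (r * b) - 1/9 * (b * b)"
      using T by (simp add: m_def)
    moreover have "0 \<le> k * (r * r)" "0 \<le> r * b" "0 \<le> b * b" using k0 r0 b0 by auto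
    ultimately have "T\<^sup>2 * m \<le> T\<^sup>2 * (z 0 \<bullet> F s)"
      using main Dq rDk by linarith
    then show ?thesis using T by simp
  qed
  have "(norm (z T))\<^sup>2 = (norm (z T - z 0))\<^sup>2 + 2 * (z 0 \<bullet> z T) - r\<^sup>2"
    by (simp add: r_def power2_norm_eq_inner inner_diff inner_commute)
  moreover have "2 * (z 0 \<bullet> z T) \<le> 2 * r\<^sup>2 - m * T\<^sup>2"
    using accelerated_byD[OF acc I(3) push] by (simp add: r_def power2_norm_eq_inner)
  moreover have "(norm (z T - z 0))\<^sup>2 \<le> D\<^sup>2"
    using dev[OF I(3)] by (intro power_mono) auto
  moreover have "D\<^sup>2 \<le> q\<^sup>2 / 2 + b * b / 2"
    using zero_le_power2[of "q - b"] by (simp add: D_def power2_eq_square algebra_simps)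
  moreover have "m * T\<^sup>2 = 7/10 * (k * (r * r)) - 132/100 * (r * b) - 1/9 * (b * b)"
    using T by (simp add: m_def)
  moreover have "0 \<le> k * (r * r)" "0 \<le> r * b" "0 \<le> b * b" using k0 r0 b0 by auto
  ultimately have "(norm (z T))\<^sup>2 \<le> r\<^sup>2 - 1/2 * (k * (r * r)) + 3/2 * (r * b) + b * b"
    using q2' by linarith
  also have "\<dots> \<le> ((1 - k / 5) * r + b)\<^sup>2"
  proof -
    have "((1 - k / 5) * r + b)\<^sup>2 = r\<^sup>2 - 2/5 * (k * (r * r)) + 1/25 * (k * r)\<^sup>2
        + 2 * (r * b) - 2/5 * (k * (r * b)) + b * b"
      by (simp add: power2_eq_square algebra_simps)
    moreover have "0 \<le> (k * r)\<^sup>2" "0 \<le> k * (r * r)" "0 \<le> r * b" using k0 r0 b0 by auto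
    ultimately show ?thesis using krb by linarith
  qed
  finally have "(norm (z T))\<^sup>2 \<le> ((1 - k / 5) * r + b)\<^sup>2" .
  moreover have "0 \<le> (1 - k / 5) * r + b"
    using kle r0 b0 by (intro add_nonneg_nonneg mult_nonneg_nonneg) auto
  ultimately have "norm (z T) \<le> (1 - k / 5) * r + b"
    by (rule power2_le_imp_le)
  then show ?thesis by (simp add: k_def r_def b_def)
qed

lemma vec_norm_le_sum: "norm (x :: 'a::real_normed_vector^'n) \<le> (\<Sum>i\<in>UNIV. norm (x $ i))"
  unfolding norm_vec_def by (rule L2_set_le_sum) simp

text \<open>The times at which two trajectories are compared: inside a time step the discretized
position is not governed by the forces at that time.\<close>

definition time_grid :: "real \<Rightarrow> real \<Rightarrow> real set" where
  "time_grid h T = (if h = 0 then {0..T} else {t \<in> {0..T}. t / h \<in> \<nat>})"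

text \<open>On a grid cell both right-hand sides are constant, so the solution is given there by the velocity
Verlet step.\<close>

lemma hmc_solution_verlet_step:
  fixes U :: "real^'d^'n \<Rightarrow> real"
  assumes sol: "hmc_solution U h x v q p" and h: "0 < h"
  defines "tk \<equiv> \<lambda>k. h * real k"
  shows "q (tk (Suc k)) $ i = q (tk k) $ i
      + h *\<^sub>R (p (tk k) $ i - (h / 2) *\<^sub>R partial_grad U i (q (tk k)))"
    and "p (tk (Suc k)) $ i = p (tk k) $ i
      - (h / 2) *\<^sub>R (partial_grad U i (q (tk k)) + partial_grad U i (q (tk (Suc k))))"
proof -
  let ?a = "tk k" and ?b = "tk (Suc k)"
  have ab: "?a \<le> ?b" "0 \<le> ?a" "?b - ?a = h" using h by (auto simp: tk_def algebra_simps)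
  have cont: "continuous_on {?a..?b} q" "continuous_on {?a..?b} p"
    using sol ab by (auto simp: hmc_solution_def intro: continuous_on_subset)
  have grid: "grid_floor h t = ?a" "grid_ceiling h t = ?b"
    "0 < t" "t \<notin> range (\<lambda>k::int. h * of_int k)" if t: "t \<in> {?a<..<?b}" for t
  proof -
    have lt: "real k < t / h" "t / h < real k + 1"
      using t h by (auto simp: tk_def field_simps)
    then have "\<lfloor>t / h\<rfloor> = int k" "\<lceil>t / h\<rceil> = int k + 1"
      by (simp_all add: floor_eq_iff ceiling_eq_iff)
    then show "grid_floor h t = ?a" "grid_ceiling h t = ?b"
      by (simp_all add: grid_floor_def grid_ceiling_def tk_def add.commute)
    show "0 < t" using t ab by auto
    show "t \<notin> range (\<lambda>k::int. h * of_int k)"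
    proof
      assume "t \<in> range (\<lambda>k::int. h * of_int k)"
      then obtain j :: int where "t = h * of_int j" by auto
      then have "of_int (int k) < (of_int j :: real)" "of_int j < (of_int (int k + 1) :: real)"
        using lt h by auto
      then show False unfolding of_int_less_iff by linarith
    qed
  qed
  have dq: "((\<lambda>s. q s $ i) has_vector_derivative
      p ?a $ i - (h / 2) *\<^sub>R partial_grad U i (q ?a)) (at t)"
    and dp: "((\<lambda>s. p s $ i) has_vector_derivative
      - (1 / 2) *\<^sub>R (partial_grad U i (q ?a) + partial_grad U i (q ?b))) (at t)"
    if t: "t \<in> {?a<..<?b}" for t
    using sol h grid(3,4)[OF t] unfolding hmc_solution_def grid(1,2)[OF t, symmetric] by auto
  have "((\<lambda>_. p ?a $ i - (h / 2) *\<^sub>R partial_grad U i (q ?a)) has_integral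
      q ?b $ i - q ?a $ i) {?a..?b}"
    by (rule fundamental_theorem_of_calculus_interior[OF ab(1) _ dq])
       (auto intro!: continuous_intros cont)
  then have "q ?b $ i - q ?a $ i = (?b - ?a) *\<^sub>R (p ?a $ i - (h / 2) *\<^sub>R partial_grad U i (q ?a))"
    using has_integral_const_real has_integral_unique ab(1) content_real by metis
  then show "q ?b $ i = q ?a $ i + h *\<^sub>R (p ?a $ i - (h / 2) *\<^sub>R partial_grad U i (q ?a))"
    using ab by (simp add: algebra_simps)
  have "((\<lambda>_. - (1 / 2) *\<^sub>R (partial_grad U i (q ?a) + partial_grad U i (q ?b))) has_integral
      p ?b $ i - p ?a $ i) {?a..?b}"
    by (rule fundamental_theorem_of_calculus_interior[OF ab(1) _ dp])
       (auto intro!: continuous_intros cont)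
  then have "p ?b $ i - p ?a $ i
      = (?b - ?a) *\<^sub>R (- (1 / 2) *\<^sub>R (partial_grad U i (q ?a) + partial_grad U i (q ?b)))"
    using has_integral_const_real has_integral_unique ab(1) content_real by metis
  then show "p ?b $ i = p ?a $ i - (h / 2) *\<^sub>R (partial_grad U i (q ?a) + partial_grad U i (q ?b))"
    using ab by (simp add: algebra_simps)
qed

text \<open>Discrete analogue of integrating twice. The half step at the start and the trapezoidal rule for
the velocity give exactly the weight \<open>(h k)\<^sup>2 / 2\<close>, with no discretization error.\<close>

lemma accelerated_by_verlet:
  fixes z w F :: "nat \<Rightarrow> 'a::real_inner"
  assumes h: "0 < h"
    and z: "\<And>k. z (Suc k) = z k + h *\<^sub>R (w k - (h / 2) *\<^sub>R F k)"
    and w: "\<And>k. w (Suc k) = w k - (h / 2) *\<^sub>R (F k + F (Suc k))"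
    and m: "\<And>k. k \<le> N \<Longrightarrow> m \<le> a \<bullet> F k" and "k \<le> N"
  shows "a \<bullet> z k \<le> a \<bullet> z 0 + (h * k) * (a \<bullet> w 0) - m * (h * k)\<^sup>2 / 2"
proof -
  have "a \<bullet> w k \<le> a \<bullet> w 0 - m * (h * k) \<and>
      a \<bullet> z k \<le> a \<bullet> z 0 + (h * k) * (a \<bullet> w 0) - m * (h * k)\<^sup>2 / 2" if "k \<le> N" for k
    using that
  proof (induction k)
    case (Suc k)
    have mk: "h * m \<le> h * (a \<bullet> F k)" "h * m \<le> h * (a \<bullet> F (Suc k))"
      using m[of k] m[of "Suc k"] Suc.prems h by auto
    have IH: "a \<bullet> w k \<le> a \<bullet> w 0 - m * (h * k)"
      "a \<bullet> z k \<le> a \<bullet> z 0 + (h * k) * (a \<bullet> w 0) - m * (h * k)\<^sup>2 / 2"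
      using Suc by auto
    have "a \<bullet> w (Suc k) = a \<bullet> w k - (h * (a \<bullet> F k) + h * (a \<bullet> F (Suc k))) / 2"
      unfolding w by (simp add: inner_diff_right inner_add_right algebra_simps)
    also have "\<dots> \<le> (a \<bullet> w 0 - m * (h * k)) - (h * m + h * m) / 2"
      by (intro diff_mono divide_right_mono add_mono mk IH) simp
    also have "\<dots> = a \<bullet> w 0 - m * (h * Suc k)" by (simp add: algebra_simps)
    finally have 1: "a \<bullet> w (Suc k) \<le> a \<bullet> w 0 - m * (h * Suc k)" .
    have "h * (a \<bullet> w k) \<le> h * (a \<bullet> w 0 - m * (h * k))"
      using IH(1) h by (intro mult_left_mono) auto
    moreover have "h * (h * m) \<le> h * (h * (a \<bullet> F k))"
      using mk(1) h by (intro mult_left_mono) auto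
    moreover have "a \<bullet> z (Suc k) = a \<bullet> z k + h * (a \<bullet> w k) - h * (h * (a \<bullet> F k)) / 2"
      unfolding z by (simp add: inner_diff_right inner_add_right algebra_simps)
    ultimately have "a \<bullet> z (Suc k) \<le> (a \<bullet> z 0 + (h * k) * (a \<bullet> w 0) - m * (h * k)\<^sup>2 / 2)
        + h * (a \<bullet> w 0 - m * (h * k)) - h * (h * m) / 2"
      using IH(2) by (simp only:)
    also have "\<dots> = a \<bullet> z 0 + (h * Suc k) * (a \<bullet> w 0) - m * (h * Suc k)\<^sup>2 / 2"
      by (simp add: power2_eq_square field_simps)
    finally have "a \<bullet> z (Suc k) \<le> a \<bullet> z 0 + (h * Suc k) * (a \<bullet> w 0) - m * (h * Suc k)\<^sup>2 / 2" .
    with 1 show ?case by simp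
  qed simp
  with \<open>k \<le> N\<close> show ?thesis by blast
qed

text \<open>Two monotonicity arguments, first for the velocity and then for the position, replace the double integral.\<close>

lemma accelerated_by_newton:
  fixes z w F :: "real \<Rightarrow> 'a::real_inner"
  assumes z: "\<And>t. 0 \<le> t \<Longrightarrow> (z has_vector_derivative w t) (at t within {0..})"
    and w: "\<And>t. 0 \<le> t \<Longrightarrow> (w has_vector_derivative - F t) (at t within {0..})"
    and m: "\<And>t. t \<in> {0..T} \<Longrightarrow> m \<le> a \<bullet> F t" and t: "t \<in> {0..T}"
  shows "a \<bullet> z t \<le> a \<bullet> z 0 + t * (a \<bullet> w 0) - m * t\<^sup>2 / 2"
proof -
  have at_eq: "at t within {0..} = at t" if "0 < t" for t :: real
    using that by (intro at_within_interior) auto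
  have zd: "(z has_vector_derivative w t) (at t)" "(w has_vector_derivative - F t) (at t)"
    if "0 < t" for t
    using z[of t] w[of t] that by (simp_all add: at_eq)
  have cont: "continuous_on {0..t} z" "continuous_on {0..t} w" for t
    by (rule continuous_on_subset[OF continuous_on_vector_derivative[of "{0..}"]];
        use z w in auto)+
  have wt: "a \<bullet> w t + m * t \<le> a \<bullet> w 0" if t: "t \<in> {0..T}" for t
  proof -
    have "a \<bullet> w t + m * t \<le> a \<bullet> w 0 + m * 0"
    proof (rule DERIV_nonpos_imp_decreasing_open[where f = "\<lambda>s. a \<bullet> w s + m * s"])
      fix s assume s: "0 < s" "s < t"
      have "((\<lambda>s. a \<bullet> w s + m * s) has_real_derivative a \<bullet> (- F s) + m) (at s)"
        using zd(2)[OF s(1)] unfolding has_vector_derivative_def has_field_derivative_def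
        by (auto intro!: derivative_eq_intros simp: algebra_simps)
      moreover have "a \<bullet> (- F s) + m \<le> 0" using m[of s] s t by simp
      ultimately show "\<exists>y. ((\<lambda>s. a \<bullet> w s + m * s) has_real_derivative y) (at s) \<and> y \<le> 0"
        by blast
    qed (use t in \<open>auto intro!: continuous_intros cont\<close>)
    then show ?thesis by simp
  qed
  have "a \<bullet> z t - t * (a \<bullet> w 0) + m * t\<^sup>2 / 2 \<le> a \<bullet> z 0 - 0 * (a \<bullet> w 0) + m * 0\<^sup>2 / 2"
  proof (rule DERIV_nonpos_imp_decreasing_open[where
        f = "\<lambda>s. a \<bullet> z s - s * (a \<bullet> w 0) + m * s\<^sup>2 / 2"])
    fix s assume s: "0 < s" "s < t"
    have "((\<lambda>s. a \<bullet> z s - s * (a \<bullet> w 0) + m * s\<^sup>2 / 2) has_real_derivative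
        a \<bullet> w s - a \<bullet> w 0 + m * s) (at s)"
      using zd(1)[OF s(1)] unfolding has_vector_derivative_def has_field_derivative_def
      by (auto intro!: derivative_eq_intros simp: algebra_simps)
    moreover have "a \<bullet> w s - a \<bullet> w 0 + m * s \<le> 0" using wt[of s] s t by simp
    ultimately show "\<exists>y. ((\<lambda>s. a \<bullet> z s - s * (a \<bullet> w 0) + m * s\<^sup>2 / 2) has_real_derivative y) (at s) \<and> y \<le> 0"
      by blast
  qed (use t in \<open>auto intro!: continuous_intros cont\<close>)
  then show ?thesis by simp
qed

lemma hmc_difference_accelerated_by:
  fixes U :: "real^'d^'n \<Rightarrow> real"
  assumes sol: "hmc_solution U h x v q p" "hmc_solution U h x' v' q' p'"
    and h: "0 \<le> h"
  shows "accelerated_by (time_grid h T) (\<lambda>s. partial_grad U i (q s) - partial_grad U i (q' s))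
     (v $ i - v' $ i) (\<lambda>s. q s $ i - q' s $ i)"
proof (cases "h = 0")
  case True
  have 0: "q 0 = x" "p 0 = v" "q' 0 = x'" "p' 0 = v'" using sol by (auto simp: hmc_solution_def)
  show ?thesis
    unfolding accelerated_by_def
  proof (intro ballI allI impI)
    fix t a m assume t: "t \<in> time_grid h T"
      and m: "\<forall>s\<in>time_grid h T. m \<le> a \<bullet> (partial_grad U i (q s) - partial_grad U i (q' s))"
    have "a \<bullet> (q t $ i - q' t $ i) \<le> a \<bullet> (q 0 $ i - q' 0 $ i)
        + t * (a \<bullet> (p 0 $ i - p' 0 $ i)) - m * t\<^sup>2 / 2"
    proof (rule accelerated_by_newton[where T = T and w = "\<lambda>t. p t $ i - p' t $ i"
          and F = "\<lambda>s. partial_grad U i (q s) - partial_grad U i (q' s)"])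
      fix s :: real assume s: "0 \<le> s"
      show "((\<lambda>s. q s $ i - q' s $ i) has_vector_derivative p s $ i - p' s $ i) (at s within {0..})"
        using sol s True by (intro has_vector_derivative_diff) (auto simp: hmc_solution_def)
      have "((\<lambda>s. p s $ i - p' s $ i) has_vector_derivative
          - partial_grad U i (q s) - - partial_grad U i (q' s)) (at s within {0..})"
        using sol s True by (intro has_vector_derivative_diff) (auto simp: hmc_solution_def)
      then show "((\<lambda>s. p s $ i - p' s $ i) has_vector_derivative
          - (partial_grad U i (q s) - partial_grad U i (q' s))) (at s within {0..})"
        by simp
    qed (use m t True in \<open>auto simp: time_grid_def\<close>)
    then show "a \<bullet> (q t $ i - q' t $ i) \<le> a \<bullet> (q 0 $ i - q' 0 $ i)
        + t * (a \<bullet> (v $ i - v' $ i)) - m * t\<^sup>2 / 2"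
      by (simp add: 0)
  qed
next
  case False
  with h have h: "0 < h" by simp
  have 0: "p 0 = v" "p' 0 = v'" using sol by (auto simp: hmc_solution_def)
  show ?thesis
    unfolding accelerated_by_def
  proof (intro ballI allI impI)
    fix t a m assume t: "t \<in> time_grid h T"
      and m: "\<forall>s\<in>time_grid h T. m \<le> a \<bullet> (partial_grad U i (q s) - partial_grad U i (q' s))"
    from t h obtain k where "t / h = real k" and tT: "t \<le> T" by (auto simp: time_grid_def elim: Nats_cases)
    then have tk: "t = h * real k" using h by (simp add: field_simps)
    have in_grid: "h * real j \<in> time_grid h T" if "j \<le> k" for j
    proof -
      have "h * real j \<le> h * real k" using that h by simp
      then have "h * real j \<le> T" using tT tk by linarith
      then show ?thesis using h by (auto simp: time_grid_def)
    qed
    have "a \<bullet> (q (h * real k) $ i - q' (h * real k) $ i) \<le> a \<bullet> (q (h * real 0) $ i - q' (h * real 0) $ i)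
        + (h * real k) * (a \<bullet> (p (h * real 0) $ i - p' (h * real 0) $ i)) - m * (h * real k)\<^sup>2 / 2"
    proof (rule accelerated_by_verlet[OF h, where N = k and w = "\<lambda>k. p (h * real k) $ i - p' (h * real k) $ i"
          and F = "\<lambda>k. partial_grad U i (q (h * real k)) - partial_grad U i (q' (h * real k))"])
      fix k
      show "q (h * real (Suc k)) $ i - q' (h * real (Suc k)) $ i =
          q (h * real k) $ i - q' (h * real k) $ i + h *\<^sub>R (p (h * real k) $ i - p' (h * real k) $ i
          - (h / 2) *\<^sub>R (partial_grad U i (q (h * real k)) - partial_grad U i (q' (h * real k))))"
        unfolding hmc_solution_verlet_step(1)[OF sol(1) h] hmc_solution_verlet_step(1)[OF sol(2) h]
        by (simp add: algebra_simps)
      show "p (h * real (Suc k)) $ i - p' (h * real (Suc k)) $ i =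
          p (h * real k) $ i - p' (h * real k) $ i
          - (h / 2) *\<^sub>R (partial_grad U i (q (h * real k)) - partial_grad U i (q' (h * real k))
          + (partial_grad U i (q (h * real (Suc k))) - partial_grad U i (q' (h * real (Suc k)))))"
        unfolding hmc_solution_verlet_step(2)[OF sol(1) h] hmc_solution_verlet_step(2)[OF sol(2) h]
        by (simp add: algebra_simps)
    qed (use m in_grid in auto)
    then show "a \<bullet> (q t $ i - q' t $ i) \<le> a \<bullet> (q 0 $ i - q' 0 $ i)
        + t * (a \<bullet> (v $ i - v' $ i)) - m * t\<^sup>2 / 2"
      by (simp add: 0 tk)
  qed
qed

section \<open>Existence of trajectories\<close>

lemma norm_integral_exp_le:
  fixes g :: "real \<Rightarrow> 'a::banach"
  assumes M: "0 < M" and t: "0 \<le> t" and cont: "continuous_on {0..t} g"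
    and g: "\<And>s. s \<in> {0..t} \<Longrightarrow> norm (g s) \<le> C * exp (2 * M * s)"
  shows "norm (integral {0..t} g) \<le> C * exp (2 * M * t) / (2 * M)"
proof -
  have int: "((\<lambda>s. C * exp (2 * M * s)) has_integral
      C * exp (2 * M * t) / (2 * M) - C * exp (2 * M * 0) / (2 * M)) {0..t}"
  proof (rule fundamental_theorem_of_calculus[OF t])
    fix s
    have "((\<lambda>s. C * exp (2 * M * s) / (2 * M)) has_real_derivative C * exp (2 * M * s)) (at s within {0..t})"
      using M by (auto intro!: derivative_eq_intros)
    then show "((\<lambda>s. C * exp (2 * M * s) / (2 * M)) has_vector_derivative C * exp (2 * M * s)) (at s within {0..t})"
      by (simp add: has_real_derivative_iff_has_vector_derivative)
  qed
  have "norm (integral {0..t} g) \<le> integral {0..t} (\<lambda>s. C * exp (2 * M * s))"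
    using int g cont by (intro integral_norm_bound_integral integrable_continuous_real)
      (auto intro!: continuous_intros)
  also have "\<dots> = C * exp (2 * M * t) / (2 * M) - C / (2 * M)"
    using integral_unique[OF int] by simp
  also have "\<dots> \<le> C * exp (2 * M * t) / (2 * M)"
  proof -
    have "0 \<le> C" using order.trans[OF norm_ge_zero g[of 0]] t by simp
    then show ?thesis using M by simp
  qed
  finally show ?thesis .
qed

text \<open>Global existence in a single application of the contraction principle: in a sup norm with the weight
\<open>exp (- 2 M t)\<close>, the Picard operator of a field with Lipschitz constant \<open>M\<close> halves distances on the whole
half-line. The unknown is the bounded function \<open>u\<close> with \<open>y t = y0 + exp (2 M t) u t\<close>.\<close>

lemma lipschitz_ode_solution_exists:
  fixes G :: "'a::banach \<Rightarrow> 'a"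
  assumes M: "0 < M" and lip: "\<And>x y. norm (G x - G y) \<le> M * norm (x - y)"
  shows "\<exists>y. y 0 = y0 \<and> (\<forall>t\<ge>0. (y has_vector_derivative G (y t)) (at t within {0..}))"
proof -
  \<comment> \<open>The space of bounded continuous functions lives on the whole line; negative times are clamped to 0.\<close>
  define cl :: "real \<Rightarrow> real" where "cl t = max 0 t" for t
  define E where "E t = exp (2 * M * t)" for t
  have E: "0 < E t" "continuous_on S E" for t S
    unfolding E_def by (auto intro!: continuous_intros)
  have contG: "continuous_on UNIV G"
    by (rule lipschitz_on_continuous_on[of M])
       (use lip M in \<open>auto intro!: lipschitz_onI simp: dist_norm\<close>)
  define path where "path u s = y0 + E s *\<^sub>R apply_bcontfun u s" for u and s :: real
  have cont: "continuous_on S (\<lambda>s. G (path u s))" for S u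
    unfolding path_def
    by (intro continuous_on_compose2[OF contG] continuous_intros E) auto
  define \<Phi> where "\<Phi> u t = (1 / E (cl t)) *\<^sub>R integral {0..cl t} (\<lambda>s. G (path u s))" for u t
  have "\<Phi> u \<in> bcontfun" for u
  proof -
    define C where "C = norm (G y0) + M * norm u"
    have "norm (\<Phi> u t) \<le> C / (2 * M)" for t
    proof -
      have "norm (integral {0..cl t} (\<lambda>s. G (path u s))) \<le> C * exp (2 * M * cl t) / (2 * M)"
      proof (rule norm_integral_exp_le[OF M])
        fix s assume s: "s \<in> {0..cl t}"
        have "1 \<le> E s" using s M by (simp add: E_def)
        have "norm (G (path u s)) \<le> norm (G y0) + norm (G (path u s) - G y0)"
          by (rule norm_triangle_sub)
        also have "\<dots> \<le> norm (G y0) * 1 + M * norm (path u s - y0)"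
          using lip by simp
        also have "\<dots> \<le> norm (G y0) * E s + M * (E s * norm u)"
          using E(1)[of s] M \<open>1 \<le> E s\<close> norm_bounded[of u s]
          by (intro add_mono mult_left_mono) (auto simp: path_def)
        finally show "norm (G (path u s)) \<le> C * exp (2 * M * s)"
          by (simp add: C_def E_def algebra_simps)
      qed (auto simp: cl_def cont)
      then have "norm (integral {0..cl t} (\<lambda>s. G (path u s))) \<le> C * E (cl t) / (2 * M)"
        by (simp add: E_def)
      then show ?thesis
        using E(1)[of "cl t"] M by (simp add: \<Phi>_def field_simps)
    qed
    moreover have "continuous_on UNIV (\<Phi> u)"
    proof -
      have "continuous_on {0..} (\<lambda>t. integral {0..t} (\<lambda>s. G (path u s)))"
      proof -
        have "((\<lambda>t. integral {0..t} (\<lambda>s. G (path u s))) has_vector_derivative G (path u t))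
            (at t within {0..})" if "t \<in> {0..}" for t
        proof -
          have "at t within {0..} = at t within {0..t+1}"
            by (rule at_within_nhd[of _ "{..<t+1}"]) auto
          then show ?thesis
            using that by (auto intro!: integral_has_vector_derivative cont)
        qed
        then show ?thesis by (rule continuous_on_vector_derivative)
      qed
      then have "continuous_on UNIV (\<lambda>t. integral {0..cl t} (\<lambda>s. G (path u s)))"
        by (rule continuous_on_compose2) (auto simp: cl_def intro!: continuous_intros)
      moreover have "continuous_on UNIV (\<lambda>t. 1 / E (cl t))"
        unfolding E_def cl_def by (intro continuous_intros) auto
      ultimately show ?thesis unfolding \<Phi>_def by (intro continuous_on_scaleR)
    qed
    ultimately show ?thesis unfolding bcontfun_def bounded_iff by auto
  qed
  then have \<Phi>: "apply_bcontfun (Bcontfun (\<Phi> u)) = \<Phi> u" for u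
    by (rule Bcontfun_inverse)
  have "\<exists>!u. Bcontfun (\<Phi> u) = u"
  proof (rule banach_fix_type[where c = "1/2"])
    show "\<forall>u v. dist (Bcontfun (\<Phi> u)) (Bcontfun (\<Phi> v)) \<le> 1/2 * dist u v"
    proof (intro allI dist_bound)
      fix u v t
      have eq: "integral {0..cl t} (\<lambda>s. G (path u s)) - integral {0..cl t} (\<lambda>s. G (path v s))
          = integral {0..cl t} (\<lambda>s. G (path u s) - G (path v s))"
        by (rule integral_diff[symmetric]) (auto intro!: integrable_continuous_real cont)
      have "norm (integral {0..cl t} (\<lambda>s. G (path u s) - G (path v s)))
          \<le> (M * dist u v) * exp (2 * M * cl t) / (2 * M)"
      proof (rule norm_integral_exp_le[OF M])
        fix s assume "s \<in> {0..cl t}"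
        have "norm (G (path u s) - G (path v s)) \<le> M * norm (path u s - path v s)" by (rule lip)
        also have "path u s - path v s = E s *\<^sub>R (apply_bcontfun u s - apply_bcontfun v s)"
          by (simp add: path_def algebra_simps)
        also have "M * norm \<dots> \<le> M * (E s * dist u v)"
          using M E(1)[of s] dist_bounded[of u s v] by (auto simp: dist_norm)
        finally show "norm (G (path u s) - G (path v s)) \<le> M * dist u v * exp (2 * M * s)"
          by (simp add: E_def algebra_simps)
      qed (auto simp: cl_def intro!: continuous_intros cont)
      also have "\<dots> = E (cl t) * (1/2 * dist u v)" using M by (simp add: E_def)
      finally show "dist (apply_bcontfun (Bcontfun (\<Phi> u)) t) (apply_bcontfun (Bcontfun (\<Phi> v)) t)
          \<le> 1/2 * dist u v"
        unfolding \<Phi> dist_norm \<Phi>_def scaleR_diff_right[symmetric] eq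
        using E(1)[of "cl t"] by (simp add: field_simps)
    qed
  qed auto
  then obtain u where "Bcontfun (\<Phi> u) = u" by blast
  then have u: "apply_bcontfun u t = \<Phi> u t" for t by (metis \<Phi>)
  have path: "path u t = y0 + integral {0..t} (\<lambda>s. G (path u s))" if "0 \<le> t" for t
    using that E(1)[of t] unfolding path_def[of u t] u[of t] \<Phi>_def cl_def by simp
  have der: "(path u has_vector_derivative G (path u t)) (at t within {0..})" if t: "0 \<le> t" for t
  proof -
    have "at t within {0..} = at t within {0..t+1}"
      by (rule at_within_nhd[of _ "{..<t+1}"]) auto
    moreover have "((\<lambda>t. integral {0..t} (\<lambda>s. G (path u s))) has_vector_derivative G (path u t))
        (at t within {0..t+1})"
      using t by (intro integral_has_vector_derivative cont) auto
    ultimately have "((\<lambda>t. y0 + integral {0..t} (\<lambda>s. G (path u s))) has_vector_derivative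
        0 + G (path u t)) (at t within {0..})"
      by (intro has_vector_derivative_add has_vector_derivative_const) simp
    then show ?thesis
      unfolding add_0 by (rule has_vector_derivative_transform_within[where d = 1])
         (use t path in auto)
  qed
  moreover have "path u 0 = y0" using path[of 0] by simp
  ultimately show ?thesis by blast
qed

text \<open>Verlet trajectories interpolate their grid values linearly. Each summand of the interpolation runs through
one grid cell and is constant elsewhere, so that continuity needs no gluing.\<close>

lemma piecewise_linear_interpolation:
  fixes a :: "nat \<Rightarrow> 'a::real_normed_vector"
  assumes h: "0 < h"
  shows "\<exists>f. (\<forall>k. f (h * real k) = a k) \<and> continuous_on UNIV f \<and>
    (\<forall>k t. h * real k < t \<longrightarrow> t < h * real (Suc k) \<longrightarrow>
      (f has_vector_derivative (1 / h) *\<^sub>R (a (Suc k) - a k)) (at t))"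
proof -
  define g where "g N t = a 0 + (\<Sum>j<N. (min h (max 0 (t - h * real j)) / h) *\<^sub>R (a (Suc j) - a j))"
    for N t
  define f where "f t = g (nat \<lceil>t / h\<rceil>) t" for t
  have g_cont: "continuous_on UNIV (g N)" for N
    unfolding g_def by (intro continuous_intros) (use h in auto)
  have f_eq: "f t = g N t" if t: "t \<le> h * real N" for N t
  proof -
    let ?M = "nat \<lceil>t / h\<rceil>"
    have M: "t \<le> h * real ?M" using h real_nat_ceiling_ge[of "t / h"] by (simp add: field_simps)
    have "?M \<le> N" using t h by (simp add: ceiling_le_iff nat_le_iff field_simps)
    then have "(\<Sum>j<N. (min h (max 0 (t - h * real j)) / h) *\<^sub>R (a (Suc j) - a j))
        = (\<Sum>j<?M. (min h (max 0 (t - h * real j)) / h) *\<^sub>R (a (Suc j) - a j))"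
    proof (intro sum.mono_neutral_right ballI)
      fix j assume "j \<in> {..<N} - {..<?M}"
      then have "h * real ?M \<le> h * real j" using h by simp
      then have "max 0 (t - h * real j) = 0" using M by simp
      then show "(min h (max 0 (t - h * real j)) / h) *\<^sub>R (a (Suc j) - a j) = 0" using h by simp
    qed auto
    then show ?thesis by (simp add: f_def g_def)
  qed
  have node: "f (h * real k) = a k" for k
  proof -
    have "min h (max 0 (h * real k - h * real j)) = h" if "j < k" for j
    proof -
      have "h * 1 \<le> h * (real k - real j)" using h that by (intro mult_left_mono) auto
      then show ?thesis by (simp add: right_diff_distrib)
    qed
    then have "(\<Sum>j<k. (min h (max 0 (h * real k - h * real j)) / h) *\<^sub>R (a (Suc j) - a j))
        = (\<Sum>j<k. a (Suc j) - a j)"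
      using h by (intro sum.cong) auto
    then show ?thesis using f_eq[of "h * real k" k] by (simp add: g_def sum_lessThan_telescope)
  qed
  have "isCont f t" for t
  proof -
    obtain N where "t / h < real N" using reals_Archimedean2 by blast
    then have "t < h * real N" using h by (simp add: field_simps)
    then have "eventually (\<lambda>s. s \<in> {..<h * real N}) (nhds t)"
      by (intro eventually_nhds_in_open) auto
    then have "eventually (\<lambda>s. f s = g N s) (nhds t)"
      by eventually_elim (simp add: f_eq)
    moreover have "isCont (g N) t" using g_cont continuous_on_eq_continuous_at by blast
    ultimately show ?thesis by (simp add: isCont_cong)
  qed
  moreover have "(f has_vector_derivative (1 / h) *\<^sub>R (a (Suc k) - a k)) (at t)"
    if t: "h * real k < t" "t < h * real (Suc k)" for k t
  proof -
    have seg: "g (Suc k) s = a k + ((s - h * real k) / h) *\<^sub>R (a (Suc k) - a k)"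
      if s: "s \<in> {h * real k <..< h * real (Suc k)}" for s
    proof -
      have "min h (max 0 (s - h * real j)) = h" if "j < k" for j
      proof -
        have "h * 1 \<le> h * (real k - real j)" using h that by (intro mult_left_mono) auto
        then have "h \<le> s - h * real j" using s by (auto simp: right_diff_distrib)
        then show ?thesis by simp
      qed
      then have "(\<Sum>j<k. (min h (max 0 (s - h * real j)) / h) *\<^sub>R (a (Suc j) - a j))
          = (\<Sum>j<k. a (Suc j) - a j)"
        using h by (intro sum.cong) auto
      moreover have "min h (max 0 (s - h * real k)) = s - h * real k"
        using s by (auto simp: algebra_simps)
      ultimately show ?thesis by (simp add: g_def sum_lessThan_telescope)
    qed
    have "((\<lambda>s. a k + ((s - h * real k) / h) *\<^sub>R (a (Suc k) - a k)) has_vector_derivative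
        (1 / h) *\<^sub>R (a (Suc k) - a k)) (at t)"
      using h by (auto intro!: derivative_eq_intros simp: has_vector_derivative_def scaleR_diff_left
          fun_eq_iff field_simps)
    then show ?thesis
      by (rule has_vector_derivative_transform_within_open[of _ _ _ "{h * real k <..< h * real (Suc k)}"])
         (use t in \<open>auto simp: seg f_eq[where N = "Suc k"] simp del: of_nat_Suc\<close>)
  qed
  ultimately show ?thesis using node
    by (intro exI[of _ f]) (auto simp: continuous_on_eq_continuous_at)
qed

lemma has_vector_derivative_nth:
  "(f has_vector_derivative f') F \<Longrightarrow> ((\<lambda>t. f t $ i) has_vector_derivative f' $ i) F"
  by (rule bounded_linear.has_vector_derivative[OF bounded_linear_vec_nth])

section \<open>Trajectories of the mean-field system\<close>

text \<open>Assumptions on one transition step, in the weakened form in which the deterministic estimates use them: the bounds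
\<open>3/20 = 3/5 * 1/4\<close> and \<open>9/50 = 3/5 * 3/10\<close> are the first two terms of the step-size condition.\<close>

locale mean_field_hmc =
  fixes V W :: "real^'d \<Rightarrow> real" and U :: "real^'d^'n \<Rightarrow> real" and \<epsilon> L Lt K R T h :: real
  assumes smooth: "C2 V" "C2 W" and \<epsilon>: "0 \<le> \<epsilon>" and U: "U = mean_field_potential V W \<epsilon>"
    and lipschitz_V: "norm (grad V a - grad V b) \<le> L * norm (a - b)"
    and lipschitz_W: "norm (grad W a - grad W b) \<le> Lt * norm (a - b)"
    and dissipative: "R \<le> norm (a - b) \<Longrightarrow> K * (norm (a - b))\<^sup>2 \<le> (a - b) \<bullet> (grad V a - grad V b)"
    and K: "0 < K" and R: "0 \<le> R" and T: "0 < T"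
    and LT: "L * T\<^sup>2 \<le> 3/20" "L\<^sup>2 * T\<^sup>2 \<le> 9/50 * K"
    and weak: "\<epsilon> * Lt \<le> K / 100"
    and h: "0 \<le> h" "h = 0 \<or> T / h \<in> \<nat>"
begin

abbreviation I :: "real set" where "I \<equiv> time_grid h T"

abbreviation far_radius :: real where "far_radius \<equiv> 8 * R * sqrt ((L + K) / K)"

definition interaction :: "real^'d^'n \<Rightarrow> 'n \<Rightarrow> real^'d" where
  "interaction x i = (\<epsilon> / real CARD('n)) *\<^sub>R
     (\<Sum>j\<in>UNIV - {i}. grad W (x $ i - x $ j) - grad W (x $ j - x $ i))"

lemma force_eq: "partial_grad U i x = grad V (x $ i) + interaction x i"
  unfolding U partial_grad_mean_field[OF smooth] interaction_def ..

lemma Lt_nonneg: "0 \<le> Lt"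
proof -
  obtain a :: "real^'d" where "norm a = 1" using vector_choose_size[of 1] by auto
  then show ?thesis using order.trans[OF norm_ge_zero lipschitz_W[of a 0]] by simp
qed

lemma K_le_L: "K \<le> L"
  using lipschitz_V dissipative by (rule dissipativity_le_lipschitz)

text \<open>Each interaction force depends on a difference of two positions; averaging over the partner gives the
own displacement and the mean displacement.\<close>

lemma interaction_lipschitz:
  "norm (interaction x i - interaction y i)
    \<le> 2 * (\<epsilon> * Lt) * (norm (x $ i - y $ i) + (\<Sum>j\<in>UNIV. norm (x $ j - y $ j)) / real CARD('n))"
proof -
  let ?n = "real CARD('n)"
  let ?z = "\<lambda>j. norm (x $ j - y $ j)"
  have n: "0 < ?n" by simp
  have term_le: "norm (grad W (x $ i - x $ j) - grad W (x $ j - x $ i)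
      - (grad W (y $ i - y $ j) - grad W (y $ j - y $ i))) \<le> 2 * Lt * (?z i + ?z j)" for j
  proof -
    have zz: "norm (x $ i - x $ j - (y $ i - y $ j)) \<le> ?z i + ?z j"
      using norm_triangle_ineq4[of "x $ i - y $ i" "x $ j - y $ j"] by (simp add: algebra_simps)
    have zz': "norm (x $ j - x $ i - (y $ j - y $ i)) \<le> ?z i + ?z j"
      using norm_triangle_ineq4[of "x $ j - y $ j" "x $ i - y $ i"] by (simp add: algebra_simps)
    have "norm (grad W (x $ i - x $ j) - grad W (x $ j - x $ i)
        - (grad W (y $ i - y $ j) - grad W (y $ j - y $ i)))
      \<le> norm (grad W (x $ i - x $ j) - grad W (y $ i - y $ j))
        + norm (grad W (x $ j - x $ i) - grad W (y $ j - y $ i))"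
      using norm_triangle_ineq4[of "grad W (x $ i - x $ j) - grad W (y $ i - y $ j)"
          "grad W (x $ j - x $ i) - grad W (y $ j - y $ i)"] by (simp add: algebra_simps)
    also have "\<dots> \<le> Lt * (?z i + ?z j) + Lt * (?z i + ?z j)"
      using zz zz' Lt_nonneg
      by (intro add_mono order.trans[OF lipschitz_W] mult_left_mono) auto
    finally show ?thesis by simp
  qed
  have "norm (interaction x i - interaction y i) =
      \<epsilon> / ?n * norm (\<Sum>j\<in>UNIV - {i}. grad W (x $ i - x $ j) - grad W (x $ j - x $ i)
      - (grad W (y $ i - y $ j) - grad W (y $ j - y $ i)))"
    using \<epsilon> by (simp add: interaction_def scaleR_diff_right[symmetric] sum_subtractf[symmetric])
  also have "\<dots> \<le> \<epsilon> / ?n * (\<Sum>j\<in>UNIV - {i}. 2 * Lt * (?z i + ?z j))"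
    using \<epsilon> by (intro mult_left_mono sum_norm_le term_le) auto
  also have "\<dots> \<le> \<epsilon> / ?n * (\<Sum>j\<in>UNIV. 2 * Lt * (?z i + ?z j))"
    using \<epsilon> Lt_nonneg by (intro mult_left_mono sum_mono2) auto
  also have "(\<Sum>j\<in>UNIV. 2 * Lt * (?z i + ?z j)) = 2 * Lt * (?n * ?z i + (\<Sum>j\<in>UNIV. ?z j))"
    by (simp add: sum_distrib_left[symmetric] sum.distrib)
  also have "\<epsilon> / ?n * \<dots> = 2 * (\<epsilon> * Lt) * (?z i + (\<Sum>j\<in>UNIV. ?z j) / ?n)"
    using n by (simp add: field_simps)
  finally show ?thesis .
qed

lemma time_grid_mem: "I \<subseteq> {0..T}" "0 \<in> I" "T \<in> I"
  using T h by (auto simp: time_grid_def)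

text \<open>All distances between the two systems at time \<open>T\<close>, with the effect of the interaction on particle \<open>i\<close> collected in
an additive error \<open>b i\<close>. Single errors cannot be controlled by data of the same particle, but their sum
can: summing over the particles turns the mean displacement into the total displacement, and the resulting
linear inequality for the total excursion closes because \<open>\<epsilon> Lt T\<^sup>2\<close> is small.\<close>

lemma trajectories_close:
  assumes sol: "hmc_solution U h x v q p" "hmc_solution U h x' v' q' p'"
    and Z: "\<And>i t. t \<in> {0..T} \<Longrightarrow> norm (x $ i - x' $ i + t *\<^sub>R (v $ i - v' $ i)) \<le> Z i"
  shows "\<exists>b. (\<forall>i. 0 \<le> b i) \<and> (\<Sum>i\<in>UNIV. b i) \<le> 5 * (\<epsilon> * Lt) * T\<^sup>2 * (\<Sum>i\<in>UNIV. Z i) \<and>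
    (\<forall>i. norm (q T $ i - q' T $ i)
       \<le> norm (x $ i - x' $ i + T *\<^sub>R (v $ i - v' $ i)) + 20/37 * (L * T\<^sup>2) * Z i + b i) \<and>
    (\<forall>i. v $ i = v' $ i \<longrightarrow> far_radius \<le> norm (x $ i - x' $ i) \<longrightarrow>
       norm (q T $ i - q' T $ i) \<le> (1 - K * T\<^sup>2 / 5) * norm (x $ i - x' $ i) + b i)"
proof -
  let ?n = "real CARD('n)"
  define z where "z i t = q t $ i - q' t $ i" for i t
  define F where "F i t = partial_grad U i (q t) - partial_grad U i (q' t)" for i t
  define F1 where "F1 i t = grad V (q t $ i) - grad V (q' t $ i)" for i t
  define F2 where "F2 i t = interaction (q t) i - interaction (q' t) i" for i t
  define S where "S i = (SUP s\<in>I. norm (z i s))" for i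
  define B where "B i = 2 * (\<epsilon> * Lt) * (S i + (\<Sum>j\<in>UNIV. S j) / ?n)" for i
  have z0: "z i 0 = x $ i - x' $ i" for i using sol by (simp add: z_def hmc_solution_def)
  have acc: "accelerated_by I (F i) (v $ i - v' $ i) (z i)" for i
    unfolding F_def z_def by (rule hmc_difference_accelerated_by[OF sol h(1)])
  have bdd: "bdd_above ((\<lambda>s. norm (z i s)) ` I)" for i
  proof -
    have "continuous_on {0..T} (\<lambda>s. norm (z i s))"
      unfolding z_def using sol
      by (auto simp: hmc_solution_def intro!: continuous_intros elim: continuous_on_subset)
    then have "compact ((\<lambda>s. norm (z i s)) ` {0..T})" by (intro compact_continuous_image) auto
    then have "bdd_above ((\<lambda>s. norm (z i s)) ` {0..T})"
      by (intro bounded_imp_bdd_above compact_imp_bounded)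
    then show ?thesis by (rule bdd_above_mono) (intro image_mono time_grid_mem)
  qed
  have zS: "norm (z i s) \<le> S i" if "s \<in> I" for i s
    unfolding S_def using that bdd by (rule cSUP_upper)
  have S0: "0 \<le> S i" for i using order.trans[OF norm_ge_zero zS[OF time_grid_mem(2)]] .
  have B0: "0 \<le> B i" for i
    unfolding B_def using S0 \<epsilon> Lt_nonneg by (intro mult_nonneg_nonneg add_nonneg_nonneg divide_nonneg_nonneg sum_nonneg) auto
  have F1: "norm (F1 i s) \<le> L * norm (z i s)" for i s
    unfolding F1_def z_def by (rule lipschitz_V)
  have F2: "norm (F2 i s) \<le> B i" if s: "s \<in> I" for i s
  proof -
    have "norm (F2 i s) \<le> 2 * (\<epsilon> * Lt) * (norm (z i s) + (\<Sum>j\<in>UNIV. norm (z j s)) / ?n)"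
      unfolding F2_def z_def by (rule interaction_lipschitz)
    also have "\<dots> \<le> B i"
      unfolding B_def using zS[OF s] \<epsilon> Lt_nonneg
      by (intro mult_left_mono add_mono divide_right_mono sum_mono) auto
    finally show ?thesis .
  qed
  have F: "F i s = F1 i s + F2 i s" for i s
    by (simp add: F_def F1_def F2_def force_eq)
  have FLB: "norm (F i s) \<le> L * norm (z i s) + B i" if "s \<in> I" for i s
    unfolding F using norm_triangle_ineq[of "F1 i s" "F2 i s"] F1[of i s] F2[OF that, of i] by linarith
  have L0: "0 \<le> L" using K_le_L K by simp
  have Z': "norm (z i 0 + t *\<^sub>R (v $ i - v' $ i)) \<le> Z i" if "t \<in> {0..T}" for i t
    using Z[OF that] by (simp add: z0)
  have exc1: "S i \<le> 40/37 * (Z i + B i * T\<^sup>2 / 2)" for i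
    using excursion_le(1)[OF acc time_grid_mem L0 LT(1) B0 bdd S_def FLB Z'] .
  have exc4: "norm (z i T) \<le> norm (z i 0 + T *\<^sub>R (v $ i - v' $ i))
      + 20/37 * (L * T\<^sup>2) * Z i + B i * T\<^sup>2" for i
    using excursion_le(4)[OF acc time_grid_mem L0 LT(1) B0 bdd S_def FLB Z'] .
  define b where "b i = B i * T\<^sup>2" for i
  define e where "e = \<epsilon> * Lt * T\<^sup>2"
  have e: "0 \<le> e" "e \<le> 1/100"
  proof -
    show "0 \<le> e" using \<epsilon> Lt_nonneg by (simp add: e_def)
    have "e \<le> K / 100 * T\<^sup>2" unfolding e_def by (intro mult_right_mono weak) auto
    also have "\<dots> \<le> L / 100 * T\<^sup>2" using K_le_L by (intro mult_right_mono) auto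
    also have "\<dots> \<le> 1/100" using LT by simp
    finally show "e \<le> 1/100" .
  qed
  have sumb: "(\<Sum>i\<in>UNIV. b i) = 4 * e * (\<Sum>i\<in>UNIV. S i)"
  proof -
    have "(\<Sum>i\<in>UNIV. b i) = 2 * e * (\<Sum>i\<in>UNIV. S i + (\<Sum>j\<in>UNIV. S j) / ?n)"
      by (simp add: b_def B_def e_def sum_distrib_left sum_distrib_right algebra_simps)
    also have "(\<Sum>i\<in>UNIV. S i + (\<Sum>j\<in>UNIV. S j) / ?n) = 2 * (\<Sum>i\<in>UNIV. S i)"
      by (simp add: sum.distrib)
    finally show ?thesis by simp
  qed
  have S_le: "S i \<le> 40/37 * (Z i + b i / 2)" for i
    using exc1[of i] by (simp add: b_def)
  have "(\<Sum>i\<in>UNIV. S i) \<le> (\<Sum>i\<in>UNIV. 40/37 * (Z i + b i / 2))"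
    by (intro sum_mono S_le)
  also have "\<dots> = 40/37 * ((\<Sum>i\<in>UNIV. Z i) + (\<Sum>i\<in>UNIV. b i) / 2)"
    by (simp add: sum_distrib_left[symmetric] sum.distrib sum_divide_distrib[symmetric])
  finally have "(\<Sum>i\<in>UNIV. S i) \<le> 40/37 * ((\<Sum>i\<in>UNIV. Z i) + 2 * (e * (\<Sum>i\<in>UNIV. S i)))"
    by (simp add: sumb)
  moreover have "e * (\<Sum>i\<in>UNIV. S i) \<le> 1/100 * (\<Sum>i\<in>UNIV. S i)"
    using e S0 by (intro mult_right_mono sum_nonneg) auto
  moreover have "0 \<le> (\<Sum>i\<in>UNIV. Z i)"
    using order.trans[OF norm_ge_zero Z[of 0]] T by (intro sum_nonneg) auto
  ultimately have "(\<Sum>i\<in>UNIV. S i) \<le> 5/4 * (\<Sum>i\<in>UNIV. Z i)"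
    by simp
  then have "4 * e * (\<Sum>i\<in>UNIV. S i) \<le> 4 * e * (5/4 * (\<Sum>i\<in>UNIV. Z i))"
    using e by (intro mult_left_mono) auto
  then have b_le: "(\<Sum>i\<in>UNIV. b i) \<le> 5 * (\<epsilon> * Lt) * T\<^sup>2 * (\<Sum>i\<in>UNIV. Z i)"
    unfolding sumb by (simp add: e_def algebra_simps)
  have far: "norm (z i T) \<le> (1 - K * T\<^sup>2 / 5) * norm (z i 0) + B i * T\<^sup>2"
    if v: "v $ i = v' $ i" and r: "far_radius \<le> norm (z i 0)" for i
  proof (rule contraction_far[OF _ time_grid_mem T L0 LT K K_le_L B0 bdd F F1 _ F2])
    show "accelerated_by I (F i) 0 (z i)" using acc[of i] v by simp
    fix s
    have "far_radius\<^sup>2 \<le> (norm (z i 0))\<^sup>2"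
      using r R K L0 by (intro power_mono) auto
    moreover have "far_radius\<^sup>2 = 64 * R\<^sup>2 * ((L + K) / K)"
      using K L0 by (simp add: power_mult_distrib)
    ultimately have "64 * R\<^sup>2 * ((L + K) / K) \<le> (norm (z i 0))\<^sup>2" by simp
    then have r2: "R\<^sup>2 * (L + K) \<le> K / 64 * (norm (z i 0))\<^sup>2"
      using K by (simp add: field_simps)
    \<comment> \<open>Dissipativity may fail at distances below \<open>R\<close>; there the loss is at most \<open>(L + K) R\<^sup>2\<close>, which the
      choice of the far radius makes a 64th part of the gain.\<close>
    show "K * (norm (z i s))\<^sup>2 - K / 64 * (norm (z i 0))\<^sup>2 \<le> z i s \<bullet> F1 i s"
    proof (cases "R \<le> norm (z i s)")
      case True
      then have "K * (norm (z i s))\<^sup>2 \<le> z i s \<bullet> F1 i s"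
        unfolding z_def F1_def by (rule dissipative)
      moreover have "0 \<le> K / 64 * (norm (z i 0))\<^sup>2" using K by simp
      ultimately show ?thesis by linarith
    next
      case False
      have "(norm (z i s))\<^sup>2 \<le> R\<^sup>2" using False by (intro power_mono) auto
      then have "(norm (z i s))\<^sup>2 * (L + K) \<le> R\<^sup>2 * (L + K)"
        using L0 K by (intro mult_right_mono) auto
      moreover have "\<bar>z i s \<bullet> F1 i s\<bar> \<le> norm (z i s) * norm (F1 i s)"
        by (rule Cauchy_Schwarz_ineq2)
      moreover have "norm (z i s) * norm (F1 i s) \<le> norm (z i s) * (L * norm (z i s))"
        by (intro mult_left_mono F1) auto
      ultimately show ?thesis using r2 by (simp add: power2_eq_square algebra_simps)
    qed
  qed
  show ?thesis
  proof (intro exI[of _ b] conjI allI impI)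
    show "0 \<le> b i" for i using B0 by (simp add: b_def)
    show "norm (q T $ i - q' T $ i)
       \<le> norm (x $ i - x' $ i + T *\<^sub>R (v $ i - v' $ i)) + 20/37 * (L * T\<^sup>2) * Z i + b i" for i
      using exc4[of i] by (simp add: z0 b_def) (simp add: z_def)
    show "norm (q T $ i - q' T $ i) \<le> (1 - K * T\<^sup>2 / 5) * norm (x $ i - x' $ i) + b i"
      if "v $ i = v' $ i" "far_radius \<le> norm (x $ i - x' $ i)" for i
      using far[of i] that by (simp add: z0 b_def) (simp add: z_def)
  qed (rule b_le)
qed

end

context mean_field_hmc
begin

lemma force_lipschitz: "\<exists>M>0. \<forall>x y. norm ((\<chi> i. partial_grad U i x) - (\<chi> i. partial_grad U i y)) \<le> M * norm (x - y)"
proof -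
  let ?n = "real CARD('n)"
  define C where "C = L + 2 * (\<epsilon> * Lt) * 2"
  have L0: "0 < L" using K_le_L K by simp
  have C0: "0 < C" unfolding C_def using \<epsilon> Lt_nonneg L0 by (intro add_pos_nonneg) auto
  have i_le: "norm (partial_grad U i x - partial_grad U i y) \<le> C * norm (x - y)" for i x y
  proof -
    have nz: "norm (x $ j - y $ j) \<le> norm (x - y)" for j
      using Finite_Cartesian_Product.norm_nth_le[of "x - y" j] by simp
    have "(\<Sum>j\<in>UNIV. norm (x $ j - y $ j)) \<le> ?n * norm (x - y)"
      using sum_mono[of UNIV "\<lambda>j. norm (x $ j - y $ j)" "\<lambda>_. norm (x - y)"] nz by simp
    then have avg: "(\<Sum>j\<in>UNIV. norm (x $ j - y $ j)) / ?n \<le> norm (x - y)"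
      by (simp add: field_simps)
    have "norm (partial_grad U i x - partial_grad U i y)
        \<le> norm (grad V (x $ i) - grad V (y $ i)) + norm (interaction x i - interaction y i)"
      unfolding force_eq
      using norm_triangle_ineq[of "grad V (x $ i) - grad V (y $ i)" "interaction x i - interaction y i"]
      by (simp add: algebra_simps)
    also have "norm (grad V (x $ i) - grad V (y $ i)) \<le> L * norm (x - y)"
      using nz[of i] L0 by (intro order.trans[OF lipschitz_V] mult_left_mono) auto
    also have "norm (interaction x i - interaction y i) \<le> 2 * (\<epsilon> * Lt) * (norm (x - y) + norm (x - y))"
      using nz[of i] avg \<epsilon> Lt_nonneg
      by (intro order.trans[OF interaction_lipschitz] mult_left_mono add_mono) auto
    finally show ?thesis by (simp add: C_def algebra_simps)
  qed
  have "norm ((\<chi> i. partial_grad U i x) - (\<chi> i. partial_grad U i y)) \<le> (?n * C) * norm (x - y)" for x y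
  proof -
    have "norm ((\<chi> i. partial_grad U i x) - (\<chi> i. partial_grad U i y))
        \<le> (\<Sum>i\<in>UNIV. norm (partial_grad U i x - partial_grad U i y))"
      using vec_norm_le_sum[of "(\<chi> i. partial_grad U i x) - (\<chi> i. partial_grad U i y)"] by simp
    also have "\<dots> \<le> (\<Sum>i\<in>(UNIV::'n set). C * norm (x - y))" by (intro sum_mono i_le)
    finally show ?thesis by simp
  qed
  moreover have "0 < ?n * C" using C0 by simp
  ultimately show ?thesis by blast
qed

lemma hamiltonian_flow_exists: "\<exists>q p. hmc_solution U 0 x v q p"
proof -
  define G where "G y = (\<chi> i. partial_grad U i y)" for y
  obtain M where M: "0 < M" "\<And>x y. norm (G x - G y) \<le> M * norm (x - y)"
    using force_lipschitz unfolding G_def by blast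
  define H where "H y = (snd y, - G (fst y))" for y :: "(real^'d^'n) \<times> (real^'d^'n)"
  have "norm (H y - H y') \<le> (1 + M) * norm (y - y')" for y y'
  proof -
    have fs: "norm (fst (y - y')) \<le> norm (y - y')" "norm (snd (y - y')) \<le> norm (y - y')"
      by (metis norm_fst_le prod.collapse) (metis norm_snd_le prod.collapse)
    have "norm (H y - H y') \<le> norm (snd y - snd y') + norm (- G (fst y) - - G (fst y'))"
      using norm_Pair_le[of "snd y - snd y'" "- G (fst y) - - G (fst y')"] by (simp add: H_def)
    also have "\<dots> \<le> norm (y - y') + M * norm (fst y - fst y')"
      using fs(2) M(2)[of "fst y" "fst y'"] by (simp add: norm_minus_commute)
    also have "\<dots> \<le> norm (y - y') + M * norm (y - y')"
      using fs(1) M(1) by simp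
    finally show ?thesis by (simp add: algebra_simps)
  qed
  from lipschitz_ode_solution_exists[of "1 + M" H "(x, v)", OF _ this] M(1)
  obtain y where y0: "y 0 = (x, v)"
    and y: "\<And>t. 0 \<le> t \<Longrightarrow> (y has_vector_derivative H (y t)) (at t within {0..})" by auto
  have fst: "((\<lambda>t. fst (y t)) has_vector_derivative snd (y t)) (at t within {0..})"
    and snd: "((\<lambda>t. snd (y t)) has_vector_derivative - G (fst (y t))) (at t within {0..})"
    if "0 \<le> t" for t
    using bounded_linear.has_vector_derivative[OF bounded_linear_fst y[OF that]]
      bounded_linear.has_vector_derivative[OF bounded_linear_snd y[OF that]]
    by (simp_all add: H_def)
  have "continuous_on {0..} (\<lambda>t. fst (y t))" "continuous_on {0..} (\<lambda>t. snd (y t))"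
    using fst snd by (auto intro!: continuous_on_vector_derivative)
  moreover have "((\<lambda>s. fst (y s) $ i) has_vector_derivative snd (y t) $ i) (at t within {0..})"
    "((\<lambda>s. snd (y s) $ i) has_vector_derivative - partial_grad U i (fst (y t))) (at t within {0..})"
    if "0 \<le> t" for t i
    using has_vector_derivative_nth[OF fst[OF that], of i] has_vector_derivative_nth[OF snd[OF that], of i]
    by (simp_all add: G_def)
  ultimately show ?thesis
    by (intro exI[of _ "\<lambda>t. fst (y t)"] exI[of _ "\<lambda>t. snd (y t)"]) (simp add: hmc_solution_def y0)
qed

lemma verlet_flow_exists:
  fixes \<tau> :: real
  assumes \<tau>: "0 < \<tau>"
  shows "\<exists>q p. hmc_solution U \<tau> x v q p"
proof -
  define G where "G y = (\<chi> i. partial_grad U i y)" for y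
  define step where "step y = (let q = fst y + \<tau> *\<^sub>R (snd y - (\<tau> / 2) *\<^sub>R G (fst y))
    in (q, snd y - (\<tau> / 2) *\<^sub>R (G (fst y) + G q)))" for y
  define s where "s k = (step ^^ k) (x, v)" for k
  have s0: "s 0 = (x, v)" by (simp add: s_def)
  have q_step: "(1 / \<tau>) *\<^sub>R (fst (s (Suc k)) - fst (s k)) = snd (s k) - (\<tau> / 2) *\<^sub>R G (fst (s k))" for k
    using \<tau> by (simp add: s_def step_def Let_def)
  have p_step: "(1 / \<tau>) *\<^sub>R (snd (s (Suc k)) - snd (s k))
      = - (1 / 2) *\<^sub>R (G (fst (s k)) + G (fst (s (Suc k))))" for k
    using \<tau> by (simp add: s_def step_def Let_def)
  obtain q where q: "\<And>k. q (\<tau> * real k) = fst (s k)" "continuous_on UNIV q"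
    "\<And>k t. \<tau> * real k < t \<Longrightarrow> t < \<tau> * real (Suc k) \<Longrightarrow>
      (q has_vector_derivative snd (s k) - (\<tau> / 2) *\<^sub>R G (fst (s k))) (at t)"
    using piecewise_linear_interpolation[OF \<tau>, of "\<lambda>k. fst (s k)"] unfolding q_step by blast
  obtain p where p: "\<And>k. p (\<tau> * real k) = snd (s k)" "continuous_on UNIV p"
    "\<And>k t. \<tau> * real k < t \<Longrightarrow> t < \<tau> * real (Suc k) \<Longrightarrow>
      (p has_vector_derivative - (1 / 2) *\<^sub>R (G (fst (s k)) + G (fst (s (Suc k))))) (at t)"
    using piecewise_linear_interpolation[OF \<tau>, of "\<lambda>k. snd (s k)"] unfolding p_step by blast
  have "((\<lambda>s. q s $ i) has_vector_derivative
           p (grid_floor \<tau> t) $ i - (\<tau> / 2) *\<^sub>R partial_grad U i (q (grid_floor \<tau> t))) (at t) \<and>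
        ((\<lambda>s. p s $ i) has_vector_derivative
           - (1 / 2) *\<^sub>R (partial_grad U i (q (grid_floor \<tau> t))
                        + partial_grad U i (q (grid_ceiling \<tau> t)))) (at t)"
    if t: "0 < t" "t \<notin> range (\<lambda>k::int. \<tau> * of_int k)" for t i
  proof -
    define k where "k = nat \<lfloor>t / \<tau>\<rfloor>"
    have fl: "\<lfloor>t / \<tau>\<rfloor> = int k" using t \<tau> by (simp add: k_def)
    then have "real k \<le> t / \<tau>" "t / \<tau> < real k + 1" by (simp_all add: floor_eq_iff)
    moreover have "t / \<tau> \<noteq> real k"
    proof
      assume "t / \<tau> = real k"
      then have "t = \<tau> * of_int (int k)" using \<tau> by (simp add: field_simps)
      with t(2) show False by blast
    qed
    ultimately have lt: "real k < t / \<tau>" "t / \<tau> < real k + 1" by auto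
    then have ce: "\<lceil>t / \<tau>\<rceil> = int (Suc k)" by (simp add: ceiling_eq_iff)
    have gf: "grid_floor \<tau> t = \<tau> * real k" "grid_ceiling \<tau> t = \<tau> * real (Suc k)"
      unfolding grid_floor_def grid_ceiling_def fl ce by simp_all
    have tt: "\<tau> * real k < t" "t < \<tau> * real (Suc k)" using lt \<tau> by (simp_all add: field_simps)
    show ?thesis
      unfolding gf q(1) p(1)
      using has_vector_derivative_nth[OF q(3)[OF tt], of i] has_vector_derivative_nth[OF p(3)[OF tt], of i]
      by (simp add: G_def)
  qed
  moreover have "q 0 = x" "p 0 = v" using q(1)[of 0] p(1)[of 0] s0 by simp_all
  ultimately show ?thesis
    using \<tau> q(2) p(2)
    by (intro exI[of _ q] exI[of _ p]) (auto simp: hmc_solution_def intro: continuous_on_subset)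
qed

lemma hmc_flow_exists: "\<exists>q p. hmc_solution U h x v q p"
  using hamiltonian_flow_exists verlet_flow_exists h(1) by (cases "h = 0") auto

text \<open>Trajectories from the same position at different velocities are compared by the same estimate. This yields both
the uniqueness of the position at time \<open>T\<close> and its continuous, hence measurable, dependence on the velocity.\<close>

lemma endpoint_lipschitz:
  assumes sol: "hmc_solution U h x v q p" "hmc_solution U h x v' q' p'"
  shows "norm (q T - q' T) \<le> real CARD('n) * (2 * T + 5 * (\<epsilon> * Lt) * T\<^sup>2 * (real CARD('n) * T)) * norm (v - v')"
proof -
  let ?n = "real CARD('n)" and ?Z = "\<lambda>_::'n. T * norm (v - v')"
  have nz: "norm (v $ i - v' $ i) \<le> norm (v - v')" for i
    using Finite_Cartesian_Product.norm_nth_le[of "v - v'" i] by simp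
  have Z: "norm (x $ i - x $ i + t *\<^sub>R (v $ i - v' $ i)) \<le> ?Z i" if "t \<in> {0..T}" for i t
    using that nz[of i] by (auto intro!: mult_mono)
  from trajectories_close[OF sol Z]
  obtain b where b0: "\<And>i. 0 \<le> b i" and b: "(\<Sum>i\<in>UNIV. b i) \<le> 5 * (\<epsilon> * Lt) * T\<^sup>2 * (\<Sum>i\<in>UNIV. ?Z i)"
    and qb: "\<And>i. norm (q T $ i - q' T $ i)
       \<le> norm (x $ i - x $ i + T *\<^sub>R (v $ i - v' $ i)) + 20/37 * (L * T\<^sup>2) * ?Z i + b i" by blast
  have "norm (q T $ i - q' T $ i) \<le> 2 * ?Z i + (\<Sum>i\<in>UNIV. b i)" for i
  proof -
    have "b i \<le> (\<Sum>i\<in>UNIV. b i)" using b0 by (intro member_le_sum) auto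
    moreover have "20/37 * (L * T\<^sup>2) * ?Z i \<le> 1 * ?Z i"
      using LT T by (intro mult_right_mono) auto
    moreover have "norm (x $ i - x $ i + T *\<^sub>R (v $ i - v' $ i)) \<le> ?Z i" using Z[of T i] T by simp
    ultimately show ?thesis using qb[of i] by linarith
  qed
  then have i_le: "norm (q T $ i - q' T $ i) \<le> 2 * ?Z i + 5 * (\<epsilon> * Lt) * T\<^sup>2 * (?n * (T * norm (v - v')))" for i
    using b by (simp, meson add_left_mono order.trans)
  have "norm (q T - q' T) \<le> (\<Sum>i\<in>UNIV. norm (q T $ i - q' T $ i))"
    using vec_norm_le_sum[of "q T - q' T"] by simp
  also have "\<dots> \<le> (\<Sum>i\<in>(UNIV::'n set). 2 * (T * norm (v - v')) + 5 * (\<epsilon> * Lt) * T\<^sup>2 * (?n * (T * norm (v - v'))))"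
    by (intro sum_mono i_le)
  finally show ?thesis by (simp add: algebra_simps)
qed

lemma hmc_position_eq:
  assumes sol: "hmc_solution U h x v q p"
  shows "hmc_position U h T x v = q T"
  unfolding hmc_position_def
proof (rule the_equality)
  show "\<exists>q' p'. hmc_solution U h x v q' p' \<and> q' T = q T" using sol by blast
next
  fix y assume "\<exists>q' p'. hmc_solution U h x v q' p' \<and> q' T = y"
  then obtain q' p' where "hmc_solution U h x v q' p'" "q' T = y" by blast
  then show "y = q T" using endpoint_lipschitz[OF sol, of v q' p'] by simp
qed

lemma continuous_hmc_position: "continuous_on UNIV (hmc_position U h T x)"
proof (rule lipschitz_on_continuous_on)
  let ?C = "real CARD('n) * (2 * T + 5 * (\<epsilon> * Lt) * T\<^sup>2 * (real CARD('n) * T))"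
  show "?C-lipschitz_on UNIV (hmc_position U h T x)"
  proof (rule lipschitz_onI)
    fix v v'
    obtain q p q' p' where sol: "hmc_solution U h x v q p" "hmc_solution U h x v' q' p'"
      using hmc_flow_exists by metis
    show "dist (hmc_position U h T x v) (hmc_position U h T x v') \<le> ?C * dist v v'"
      unfolding dist_norm hmc_position_eq[OF sol(1)] hmc_position_eq[OF sol(2)]
      by (rule endpoint_lipschitz[OF sol])
    show "0 \<le> ?C" using T \<epsilon> Lt_nonneg by simp
  qed
qed

end

section \<open>The concave distance function\<close>

text \<open>All properties follow from the decreasing derivative \<open>exp (- min R1 s / T)\<close>, which is at most 1.\<close>

lemma
  fixes R1 T :: real
  assumes T: "0 < T" and R1: "0 \<le> R1"
  shows dist_fun_tangent: "0 \<le> a \<Longrightarrow> 0 \<le> b \<Longrightarrow>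
      dist_fun R1 T b \<le> dist_fun R1 T a + exp (- min R1 a / T) * (b - a)"
    and dist_fun_mono: "0 \<le> a \<Longrightarrow> a \<le> b \<Longrightarrow> dist_fun R1 T a \<le> dist_fun R1 T b"
    and dist_fun_add_le: "0 \<le> a \<Longrightarrow> 0 \<le> d \<Longrightarrow> dist_fun R1 T (a + d) \<le> dist_fun R1 T a + d"
    and dist_fun_le_id: "0 \<le> a \<Longrightarrow> dist_fun R1 T a \<le> a"
    and dist_fun_nonneg: "0 \<le> a \<Longrightarrow> 0 \<le> dist_fun R1 T a"
    and dist_fun_R1: "0 \<le> a \<Longrightarrow> a \<le> R1 \<Longrightarrow>
      dist_fun R1 T R1 = dist_fun R1 T a + T * (exp (- a / T) - exp (- R1 / T))"
proof -
  let ?g = "\<lambda>s. exp (- min R1 s / T)"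
  have int: "?g integrable_on {a..b}" for a b
    by (intro integrable_continuous_real continuous_intros) (use T in auto)
  have diff: "dist_fun R1 T b = dist_fun R1 T a + integral {a..b} ?g" if "0 \<le> a" "a \<le> b" for a b
    unfolding dist_fun_def using Henstock_Kurzweil_Integration.integral_combine[OF that int] by simp
  have anti: "?g t \<le> ?g s" if "s \<le> t" for s t
    using that T by (simp add: divide_right_mono)
  show tangent: "dist_fun R1 T b \<le> dist_fun R1 T a + ?g a * (b - a)" if "0 \<le> a" "0 \<le> b" for a b
  proof (cases "a \<le> b")
    case True
    have "integral {a..b} ?g \<le> integral {a..b} (\<lambda>_. ?g a)"
      by (intro integral_le int integrable_const_ivl anti) auto
    then show ?thesis using diff[OF that(1) True] True by (simp add: mult.commute)
  next
    case False
    have "integral {b..a} (\<lambda>_. ?g a) \<le> integral {b..a} ?g"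
      by (intro integral_le int integrable_const_ivl anti) auto
    then show ?thesis using diff[of b a] that False by (simp add: algebra_simps)
  qed
  show "dist_fun R1 T a \<le> dist_fun R1 T b" if "0 \<le> a" "a \<le> b" for a b
    using diff[OF that] integral_nonneg[OF int, of a b] by simp
  have 0: "dist_fun R1 T 0 = 0" by (simp add: dist_fun_def)
  show add: "dist_fun R1 T (a + d) \<le> dist_fun R1 T a + d" if "0 \<le> a" "0 \<le> d" for a d
  proof -
    have "?g a * d \<le> 1 * d" using that R1 T by (intro mult_right_mono) auto
    with tangent[of a "a + d"] that show ?thesis by simp
  qed
  show "dist_fun R1 T a \<le> a" if "0 \<le> a" using add[of 0 a] that 0 by simp
  show "0 \<le> dist_fun R1 T a" if "0 \<le> a"
    unfolding dist_fun_def by (intro integral_nonneg int) simp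
  show "dist_fun R1 T R1 = dist_fun R1 T a + T * (exp (- a / T) - exp (- R1 / T))"
    if a: "0 \<le> a" "a \<le> R1"
  proof -
    have "((\<lambda>s. exp (- s / T)) has_integral (- T * exp (- R1 / T)) - (- T * exp (- a / T))) {a..R1}"
    proof (rule fundamental_theorem_of_calculus[OF a(2)])
      fix s
      have "((\<lambda>s. - T * exp (- s / T)) has_real_derivative exp (- s / T)) (at s within {a..R1})"
        using T by (auto intro!: derivative_eq_intros)
      then show "((\<lambda>s. - T * exp (- s / T)) has_vector_derivative exp (- s / T)) (at s within {a..R1})"
        by (simp add: has_real_derivative_iff_has_vector_derivative)
    qed
    then have "(?g has_integral (- T * exp (- R1 / T)) - (- T * exp (- a / T))) {a..R1}"
      by (rule has_integral_eq[rotated]) auto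
    then have "integral {a..R1} ?g = T * (exp (- a / T) - exp (- R1 / T))"
      by (simp add: integral_unique algebra_simps)
    then show ?thesis using diff[OF a] by simp
  qed
qed

lemma dist_fun_contraction:
  assumes T: "0 < T" and R1: "0 \<le> R1" and r: "0 \<le> r" and \<kappa>: "0 \<le> \<kappa>" "\<kappa> \<le> 1"
  shows "dist_fun R1 T ((1 - \<kappa>) * r) \<le> dist_fun R1 T r - exp (- min R1 r / T) * (\<kappa> * r)"
proof -
  have "0 \<le> (1 - \<kappa>) * r" using r \<kappa> by simp
  from dist_fun_tangent[OF T R1 r this] show ?thesis by (simp add: algebra_simps)
qed

text \<open>A reflection may enlarge the distance to \<open>5/4 (r + 2 T s)\<close>, where \<open>s\<close> is the size of the reflected
velocity component. The increase of the distance function up to \<open>R1\<close> costs at most \<open>T exp (- r / T)\<close>; beyond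
\<open>R1\<close> the slope is only \<open>exp (- R1 / T)\<close>.\<close>

lemma dist_fun_after_reflection:
  assumes T: "0 < T" and Rt: "0 \<le> Rt" and r: "0 \<le> r" "r \<le> Rt" and s: "0 \<le> s"
    and R1: "R1 = 5/4 * (Rt + 2 * T)"
  shows "dist_fun R1 T (5/4 * (r + 2 * (T * s)))
    \<le> dist_fun R1 T r + T * exp (- r / T) + 5/2 * (T * exp (- R1 / T) * s)"
proof -
  have R1_pos: "0 \<le> R1" "r \<le> R1" using R1 Rt T r by auto
  \<comment> \<open>The tangent at \<open>R1\<close> is used on both sides of \<open>R1\<close>, so no case distinction is needed.\<close>
  have "dist_fun R1 T (5/4 * (r + 2 * (T * s))) \<le> dist_fun R1 T (5/4 * (Rt + 2 * (T * s)))"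
    using r s T by (intro dist_fun_mono[OF T R1_pos(1)]) auto
  also have "\<dots> \<le> dist_fun R1 T R1 + exp (- min R1 R1 / T) * (5/4 * (Rt + 2 * (T * s)) - R1)"
    using R1_pos Rt T s by (intro dist_fun_tangent[OF T R1_pos(1)]) auto
  also have "5/4 * (Rt + 2 * (T * s)) - R1 = 5/2 * (T * s) - 5/2 * T" by (simp add: R1 field_simps)
  also have "dist_fun R1 T R1 + exp (- min R1 R1 / T) * (5/2 * (T * s) - 5/2 * T)
      = dist_fun R1 T R1 + exp (- R1 / T) * (5/2 * (T * s)) - exp (- R1 / T) * (5/2 * T)"
    by (simp add: right_diff_distrib)
  also have "dist_fun R1 T R1 = dist_fun R1 T r + T * (exp (- r / T) - exp (- R1 / T))"
    by (rule dist_fun_R1[OF T R1_pos(1) r(1) R1_pos(2)])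
  finally have "dist_fun R1 T (5/4 * (r + 2 * (T * s)))
    \<le> dist_fun R1 T r + T * (exp (- r / T) - exp (- R1 / T))
      + exp (- R1 / T) * (5/2 * (T * s)) - exp (- R1 / T) * (5/2 * T)" .
  moreover have "0 \<le> exp (- R1 / T) * T" using T by simp
  ultimately show ?thesis by (simp add: algebra_simps)
qed

section \<open>The coupled Gaussian velocities\<close>

text \<open>The product density makes the coordinates independent, and a linear combination of independent normal variables
is normal. Coordinates with coefficient 0 are left out of the sum since a normal density needs a positive variance.\<close>

lemma (in prob_space) std_normal_projection:
  fixes \<xi> :: "'a \<Rightarrow> 'b::euclidean_space"
  assumes \<xi>: "distributed M lborel \<xi> (\<lambda>v. ennreal (\<Prod>b\<in>Basis. std_normal_density (v \<bullet> b)))"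
    and c: "norm c = 1"
  shows "distributed M lborel (\<lambda>\<omega>. c \<bullet> \<xi> \<omega>) std_normal_density"
proof -
  define N where "N = density lborel (\<lambda>x::real. ennreal (std_normal_density x))"
  have N: "prob_space N" unfolding N_def by (rule prob_space_normal_density) simp
  have [measurable]: "\<xi> \<in> borel_measurable M" using distributed_measurable[OF \<xi>] by simp
  let ?X = "\<lambda>b \<omega>. \<xi> \<omega> \<bullet> b"
  have law: "distr M (Pi\<^sub>M Basis (\<lambda>_. borel)) (\<lambda>\<omega>. \<lambda>b\<in>Basis. ?X b \<omega>) = Pi\<^sub>M Basis (\<lambda>_. N)"
  proof (rule product_sigma_finite.PiM_eqI)
    show "product_sigma_finite (\<lambda>_::'b. N)"
      by (intro product_sigma_finite.intro prob_space_imp_sigma_finite N)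
    show "finite (Basis :: 'b set)" by simp
    show "sets (distr M (Pi\<^sub>M Basis (\<lambda>_. borel)) (\<lambda>\<omega>. \<lambda>b\<in>Basis. ?X b \<omega>)) = sets (Pi\<^sub>M Basis (\<lambda>_. N))"
      by (auto simp: N_def intro!: sets_PiM_cong)
    fix A :: "'b \<Rightarrow> real set" assume A: "\<And>b. b \<in> Basis \<Longrightarrow> A b \<in> sets N"
    then have A': "\<And>b. b \<in> Basis \<Longrightarrow> A b \<in> sets borel" by (simp add: N_def)
    define \<phi> where "\<phi> b x = ennreal (std_normal_density x) * indicator (A b) x" for b x
    have \<phi>_meas: "\<phi> b \<in> borel_measurable borel" if "b \<in> Basis" for b
      unfolding \<phi>_def using A'[OF that] by measurable
    have mAll: "{v::'b. \<forall>b\<in>Basis. v \<bullet> b \<in> A b} \<in> sets borel"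
    proof -
      have "{v::'b. \<forall>b\<in>Basis. v \<bullet> b \<in> A b} = (\<Inter>b\<in>Basis. (\<lambda>v. v \<bullet> b) -` A b \<inter> space borel)" by auto
      moreover have "(\<lambda>v::'b. v \<bullet> b) -` A b \<inter> space borel \<in> sets borel" if "b \<in> Basis" for b
        by (rule measurable_sets[OF _ A'[OF that]]) measurable
      ultimately show ?thesis using nonempty_Basis by (auto intro!: sets.finite_INT)
    qed
    have "emeasure (distr M (Pi\<^sub>M Basis (\<lambda>_. borel)) (\<lambda>\<omega>. \<lambda>b\<in>Basis. ?X b \<omega>)) (Pi\<^sub>E Basis A)
        = emeasure M ((\<lambda>\<omega>. \<lambda>b\<in>Basis. ?X b \<omega>) -` (Pi\<^sub>E Basis A) \<inter> space M)"
      using A' by (intro emeasure_distr) (auto intro!: sets_PiM_I_finite)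
    also have "(\<lambda>\<omega>. \<lambda>b\<in>Basis. ?X b \<omega>) -` (Pi\<^sub>E Basis A) \<inter> space M
        = \<xi> -` {v. \<forall>b\<in>Basis. v \<bullet> b \<in> A b} \<inter> space M"
      by (auto simp: PiE_iff)
    also have "emeasure M \<dots> = (\<integral>\<^sup>+v. ennreal (\<Prod>b\<in>Basis. std_normal_density (v \<bullet> b))
          * indicator {v. \<forall>b\<in>Basis. v \<bullet> b \<in> A b} v \<partial>lborel)"
      using mAll by (intro distributed_emeasure[OF \<xi>]) simp
    also have "\<dots> = (\<integral>\<^sup>+v. (\<Prod>b\<in>Basis. \<phi> b (v \<bullet> b)) \<partial>lborel)"
    proof (intro nn_integral_cong)
      fix v :: 'b
      have "indicator {v. \<forall>b\<in>Basis. v \<bullet> b \<in> A b} v = (\<Prod>b\<in>Basis. indicator (A b) (v \<bullet> b) :: ennreal)"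
      proof (cases "\<forall>b\<in>Basis. v \<bullet> b \<in> A b")
        case False
        then obtain b where "b \<in> Basis" "v \<bullet> b \<notin> A b" by blast
        then have "(\<Prod>b\<in>Basis. indicator (A b) (v \<bullet> b) :: ennreal) = 0"
          by (intro prod_zero) (auto intro!: bexI[of _ b])
        then show ?thesis using False by simp
      qed simp
      then show "ennreal (\<Prod>b\<in>Basis. std_normal_density (v \<bullet> b))
          * indicator {v. \<forall>b\<in>Basis. v \<bullet> b \<in> A b} v = (\<Prod>b\<in>Basis. \<phi> b (v \<bullet> b))"
        by (simp add: \<phi>_def prod.distrib prod_ennreal)
    qed
    also have "\<dots> = (\<Prod>b\<in>(Basis::'b set). \<integral>\<^sup>+x. \<phi> b x \<partial>lborel)"
      by (rule nn_integral_lborel_prod) (auto intro: \<phi>_meas)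
    also have "\<dots> = (\<Prod>b\<in>(Basis::'b set). emeasure N (A b))"
      unfolding N_def \<phi>_def using A' by (intro prod.cong refl) (simp add: emeasure_density)
    finally show "emeasure (distr M (Pi\<^sub>M Basis (\<lambda>_. borel)) (\<lambda>\<omega>. \<lambda>b\<in>Basis. ?X b \<omega>)) (Pi\<^sub>E Basis A)
        = (\<Prod>b\<in>(Basis::'b set). emeasure N (A b))" .
  qed
  have comp: "distr M borel (?X b) = N" if b: "b \<in> Basis" for b
  proof -
    have "distr M borel (?X b) = distr M N (?X b)" by (rule distr_cong) (simp_all add: N_def)
    also have "\<dots> = distr M N ((\<lambda>f. f b) \<circ> (\<lambda>\<omega>. \<lambda>b\<in>Basis. ?X b \<omega>))"
      using b by (intro distr_cong) auto
    also have "\<dots> = distr (distr M (Pi\<^sub>M Basis (\<lambda>_. borel)) (\<lambda>\<omega>. \<lambda>b\<in>Basis. ?X b \<omega>)) N (\<lambda>f. f b)"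
      using b by (subst distr_distr) (auto simp: N_def intro!: measurable_component_singleton)
    also have "\<dots> = N" unfolding law using N b by (intro distr_PiM_component) auto
    finally show ?thesis .
  qed
  have indep: "indep_vars (\<lambda>_. borel) ?X Basis"
    by (subst indep_vars_iff_distr_eq_PiM') (auto simp: law comp intro!: PiM_cong)
  have normal: "distributed M lborel (?X b) std_normal_density" if "b \<in> Basis" for b
    using comp[OF that] unfolding distributed_def N_def by (simp cong: distr_cong)
  define J where "J = {b\<in>Basis. c \<bullet> b \<noteq> 0}"
  have J: "finite J" "J \<subseteq> Basis" by (auto simp: J_def)
  have sumJ: "(\<Sum>b\<in>J. g b) = (\<Sum>b\<in>Basis. g b)" if "\<And>b. c \<bullet> b = 0 \<Longrightarrow> g b = 0" for g :: "'b \<Rightarrow> real"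
    using that by (intro sum.mono_neutral_left) (auto simp: J_def)
  have sq: "(\<Sum>b\<in>J. \<bar>c \<bullet> b\<bar>\<^sup>2) = 1"
  proof -
    have "c \<bullet> c = (\<Sum>b\<in>Basis. (c \<bullet> b) * (c \<bullet> b))" by (rule euclidean_inner)
    moreover have "c \<bullet> c = 1" using c by (simp add: norm_eq_1)
    ultimately show ?thesis by (subst sumJ) (simp_all add: power2_eq_square)
  qed
  have "J \<noteq> {}" using sq by auto
  have "distributed M lborel (\<lambda>\<omega>. \<Sum>b\<in>J. (c \<bullet> b) * ?X b \<omega>)
      (normal_density (\<Sum>b\<in>J. 0) (sqrt (\<Sum>b\<in>J. \<bar>c \<bullet> b\<bar>\<^sup>2)))"
  proof (rule sum_indep_normal[OF J(1) \<open>J \<noteq> {}\<close>])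
    show "indep_vars (\<lambda>_. borel) (\<lambda>b \<omega>. (c \<bullet> b) * ?X b \<omega>) J"
      by (rule indep_vars_compose2[OF indep_vars_subset[OF indep J(2)]]) measurable
    fix b assume b: "b \<in> J"
    then show "0 < \<bar>c \<bullet> b\<bar>" by (simp add: J_def)
    show "distributed M lborel (\<lambda>\<omega>. (c \<bullet> b) * ?X b \<omega>) (normal_density 0 \<bar>c \<bullet> b\<bar>)"
      using normal_density_affine[OF normal[of b], of "c \<bullet> b" 0] b by (simp add: J_def)
  qed
  then have "distributed M lborel (\<lambda>\<omega>. \<Sum>b\<in>J. (c \<bullet> b) * ?X b \<omega>) std_normal_density"
    unfolding sq by simp
  also have "(\<lambda>\<omega>. \<Sum>b\<in>J. (c \<bullet> b) * ?X b \<omega>) = (\<lambda>\<omega>. c \<bullet> \<xi> \<omega>)"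
  proof
    fix \<omega>
    have "c \<bullet> \<xi> \<omega> = (\<Sum>b\<in>Basis. (c \<bullet> b) * ?X b \<omega>)" by (rule euclidean_inner)
    then show "(\<Sum>b\<in>J. (c \<bullet> b) * ?X b \<omega>) = c \<bullet> \<xi> \<omega>" by (subst sumJ) auto
  qed
  finally show ?thesis .
qed

lemma prod_Basis_vec:
  "(\<Prod>b\<in>(Basis :: (real^'d^'n) set). g (v \<bullet> b)) = (\<Prod>i\<in>UNIV. \<Prod>k\<in>UNIV. g (v $ i $ k))"
  for g :: "real \<Rightarrow> 'c::comm_monoid_mult"
proof -
  have eq: "(Basis :: (real^'d^'n) set) = (\<lambda>(i, k). axis i (axis k 1)) ` UNIV"
    by (auto simp: Basis_vec_def image_iff)
  have inj: "inj (\<lambda>(i, k). axis i (axis k 1) :: real^'d^'n)"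
    by (auto simp: inj_on_def axis_eq_axis)
  have "(\<Prod>b\<in>(Basis :: (real^'d^'n) set). g (v \<bullet> b))
      = (\<Prod>(i, k)\<in>UNIV. g (v \<bullet> axis i (axis k 1)))"
    unfolding eq by (subst prod.reindex[OF inj]) (simp add: case_prod_unfold)
  also have "\<dots> = (\<Prod>(i, k)\<in>UNIV \<times> UNIV. g (v $ i $ k))"
    by (intro prod.cong) (auto simp: inner_axis)
  also have "\<dots> = (\<Prod>i\<in>UNIV. \<Prod>k\<in>UNIV. g (v $ i $ k))"
    by (simp add: prod.cartesian_product)
  finally show ?thesis .
qed

lemma std_normal_density_ratio:
  "std_normal_density (x + a) / std_normal_density x = exp (- (a * x + a\<^sup>2 / 2))"
proof -
  have "std_normal_density (x + a) = exp (- (a * x + a\<^sup>2 / 2)) * std_normal_density x"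
    unfolding std_normal_density_def
    by (simp add: exp_add[symmetric] power2_eq_square field_simps)
  moreover have "0 < std_normal_density x" by (rule normal_density_pos) simp
  ultimately show ?thesis by (simp add: divide_eq_eq)
qed

context prob_space
begin

text \<open>Given \<open>s = x\<close>, rejection has probability at most \<open>1 - exp (- (a x + a\<^sup>2 / 2))\<close> if this is positive and 0 otherwise, so at most
\<open>a (max 0 x + a / 2)\<close>. This linear bound reduces all expectations over rejections to absolute moments of the normal
distribution, each with a factor \<open>a\<close>.\<close>

lemma rejection_nn_integral_le:
  fixes s u :: "'a \<Rightarrow> real" and g :: "real \<Rightarrow> real"
  assumes s: "distributed M lborel s std_normal_density"
    and u: "distributed M lborel u (indicator {0..1})"
    and indep: "indep_var borel s borel u"
    and g[measurable]: "g \<in> borel_measurable borel" and g0: "\<And>x. 0 \<le> g x" and a: "0 \<le> a"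
  shows "(\<integral>\<^sup>+\<omega>. ennreal (if u \<omega> \<le> std_normal_density (s \<omega> + a) / std_normal_density (s \<omega>)
      then 0 else g (s \<omega>)) \<partial>M)
    \<le> (\<integral>\<^sup>+x. ennreal (std_normal_density x * (g x * (a * (max 0 x + a / 2)))) \<partial>lborel)"
proof -
  have "distributed M (lborel \<Otimes>\<^sub>M lborel) (\<lambda>\<omega>. (s \<omega>, u \<omega>))
      (\<lambda>(x, y). ennreal (std_normal_density x) * indicator {0..1} y)"
    using distributed_joint_indep'[OF _ _ s u] indep lborel.sigma_finite_measure_axioms
    by (simp add: indep_var_distribution_eq cong: distr_cong)
  from distributed_nn_integral[OF this, of "\<lambda>(x, y). ennreal (if y \<le> exp (- (a * x + a\<^sup>2 / 2)) then 0 else g x)"]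
  have "(\<integral>\<^sup>+\<omega>. ennreal (if u \<omega> \<le> exp (- (a * s \<omega> + a\<^sup>2 / 2)) then 0 else g (s \<omega>)) \<partial>M)
    = (\<integral>\<^sup>+z. (case z of (x, y) \<Rightarrow> (ennreal (std_normal_density x) * indicator {0..1} y) *
        ennreal (if y \<le> exp (- (a * x + a\<^sup>2 / 2)) then 0 else g x)) \<partial>(lborel \<Otimes>\<^sub>M lborel))"
    by (simp add: case_prod_unfold) (simp only: fst_conv)
  also have "\<dots> = (\<integral>\<^sup>+x. (\<integral>\<^sup>+y. (ennreal (std_normal_density x) * indicator {0..1} y) *
        ennreal (if y \<le> exp (- (a * x + a\<^sup>2 / 2)) then 0 else g x) \<partial>lborel) \<partial>lborel)"
    by (subst lborel.nn_integral_fst[symmetric]) (simp_all add: case_prod_unfold, simp only: fst_conv)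
  also have "\<dots> \<le> (\<integral>\<^sup>+x. ennreal (std_normal_density x * (g x * (a * (max 0 x + a / 2)))) \<partial>lborel)"
  proof (rule nn_integral_mono)
    fix x
    let ?E = "exp (- (a * x + a\<^sup>2 / 2))"
    have "(\<integral>\<^sup>+y. (ennreal (std_normal_density x) * indicator {0..1} y) *
        ennreal (if y \<le> ?E then 0 else g x) \<partial>lborel)
      = (\<integral>\<^sup>+y. ennreal (std_normal_density x * g x) * indicator {y \<in> {0..1}. ?E < y} y \<partial>lborel)"
      by (intro nn_integral_cong) (auto simp: indicator_def ennreal_mult' g0)
    also have "\<dots> = ennreal (std_normal_density x * g x) * emeasure lborel {y \<in> {0..1}. ?E < y}"
      by (rule nn_integral_cmult_indicator) measurable
    also have "\<dots> \<le> ennreal (std_normal_density x * g x) * ennreal (a * (max 0 x + a / 2))"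
    proof (rule mult_left_mono)
      have "emeasure lborel {y \<in> {0..1}. ?E < y} \<le> emeasure lborel {?E<..max ?E 1}"
        by (intro emeasure_mono) auto
      also have "\<dots> = ennreal (max ?E 1 - ?E)" by simp
      also have "max ?E 1 - ?E \<le> max 0 (a * x + a\<^sup>2 / 2)"
        using exp_ge_add_one_self[of "- (a * x + a\<^sup>2 / 2)"] by linarith
      also have "max 0 (a * x + a\<^sup>2 / 2) \<le> a * (max 0 x + a / 2)"
        using a mult_left_mono[of x "max 0 x" a] by (simp add: power2_eq_square algebra_simps)
      finally show "emeasure lborel {y \<in> {0..1}. ?E < y} \<le> ennreal (a * (max 0 x + a / 2))"
        by (simp add: ennreal_leI)
    qed simp
    also have "\<dots> = ennreal (std_normal_density x * (g x * (a * (max 0 x + a / 2))))"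
      using a g0 by (simp add: ennreal_mult[symmetric] mult.assoc)
    finally show "(\<integral>\<^sup>+y. (ennreal (std_normal_density x) * indicator {0..1} y) *
        ennreal (if y \<le> ?E then 0 else g x) \<partial>lborel)
      \<le> ennreal (std_normal_density x * (g x * (a * (max 0 x + a / 2))))" .
  qed
  finally show ?thesis unfolding std_normal_density_ratio .
qed

text \<open>The constants come from the normal moments: \<open>21/40 \<ge> sqrt (2 / pi) / 2 + 1/8\<close> and \<open>9/8 \<ge> 1 + sqrt (2 / pi) / 8\<close>, both with
\<open>a / 2 \<le> 1/8\<close>. The first one matters: the contraction of accepted moves has to outweigh it.\<close>

lemma rejection_bounds:
  fixes s u :: "'a \<Rightarrow> real"
  assumes s: "distributed M lborel s std_normal_density"
    and u: "distributed M lborel u (indicator {0..1})"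
    and indep: "indep_var borel s borel u"
    and a: "0 \<le> a" "a \<le> 1/4"
  defines "accept \<equiv> \<lambda>\<omega>. u \<omega> \<le> std_normal_density (s \<omega> + a) / std_normal_density (s \<omega>)"
  shows "integrable M (\<lambda>\<omega>. if accept \<omega> then 0 else 1 :: real)"
    and "(\<integral>\<omega>. (if accept \<omega> then 0 else 1) \<partial>M) \<le> 21/40 * a"
    and "integrable M (\<lambda>\<omega>. if accept \<omega> then 0 else \<bar>s \<omega>\<bar>)"
    and "(\<integral>\<omega>. (if accept \<omega> then 0 else \<bar>s \<omega>\<bar>) \<partial>M) \<le> 9/8 * a"
proof -
  have [measurable]: "s \<in> borel_measurable M" "u \<in> borel_measurable M"
    using distributed_measurable[OF s] distributed_measurable[OF u] by simp_all
  \<comment> \<open>A dominating function \<open>G\<close> with known normal expectation \<open>c\<close>.\<close>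
  have *: "integrable M (\<lambda>\<omega>. if accept \<omega> then 0 else g (s \<omega>)) \<and>
      (\<integral>\<omega>. (if accept \<omega> then 0 else g (s \<omega>)) \<partial>M) \<le> c"
    if g[measurable]: "g \<in> borel_measurable borel" and g0: "\<And>x. 0 \<le> g x"
      and G: "has_bochner_integral lborel (\<lambda>x. std_normal_density x * G x) c"
      and le: "\<And>x. g x * (a * (max 0 x + a / 2)) \<le> G x" for g G :: "real \<Rightarrow> real" and c
  proof -
    have pos: "0 \<le> std_normal_density x * G x" for x
      using g0[of x] a le[of x] by (intro mult_nonneg_nonneg) (auto intro: order.trans[rotated])
    have "0 \<le> (\<integral>x. std_normal_density x * G x \<partial>lborel)"
      by (intro Bochner_Integration.integral_nonneg pos)
    then have c0: "0 \<le> c" using has_bochner_integral_integral_eq[OF G] by simp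
    have "(\<integral>\<^sup>+\<omega>. ennreal (if accept \<omega> then 0 else g (s \<omega>)) \<partial>M)
      \<le> (\<integral>\<^sup>+x. ennreal (std_normal_density x * (g x * (a * (max 0 x + a / 2)))) \<partial>lborel)"
      unfolding accept_def by (rule rejection_nn_integral_le[OF s u indep g g0 a(1)])
    also have "\<dots> \<le> (\<integral>\<^sup>+x. ennreal (std_normal_density x * G x) \<partial>lborel)"
      by (intro nn_integral_mono ennreal_leI mult_left_mono le) simp
    also have "\<dots> = ennreal c"
      using nn_integral_eq_integral[OF integrable.intros[OF G]] pos
        has_bochner_integral_integral_eq[OF G] by simp
    finally have nn: "(\<integral>\<^sup>+\<omega>. ennreal (if accept \<omega> then 0 else g (s \<omega>)) \<partial>M) \<le> ennreal c" .
    have meas: "(\<lambda>\<omega>. if accept \<omega> then 0 else g (s \<omega>)) \<in> borel_measurable M"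
      unfolding accept_def by measurable
    have int: "integrable M (\<lambda>\<omega>. if accept \<omega> then 0 else g (s \<omega>))"
      using meas nn g0 by (intro integrableI_nonneg) (auto intro: le_less_trans)
    have "ennreal (\<integral>\<omega>. (if accept \<omega> then 0 else g (s \<omega>)) \<partial>M) \<le> ennreal c"
      using nn g0 by (subst nn_integral_eq_integral[OF int, symmetric]) auto
    then show ?thesis using int c0 by simp
  qed
  have one: "has_bochner_integral lborel std_normal_density 1"
    using std_normal_moment_even[of 0] by simp
  have x1: "has_bochner_integral lborel (\<lambda>x. std_normal_density x * x) 0"
    using std_normal_moment_odd[of 0] by simp
  have abs1: "has_bochner_integral lborel (\<lambda>x. std_normal_density x * \<bar>x\<bar>) (sqrt (2 / pi))"
    using std_normal_moment_abs_odd[of 0] by simp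
  have x2: "has_bochner_integral lborel (\<lambda>x. std_normal_density x * x\<^sup>2) 1"
    using std_normal_moment_even[of 1] by (simp add: power2_eq_square fact_numeral)
  have m: "sqrt (2 / pi) \<le> 4/5"
  proof (rule real_le_lsqrt)
    show "2 / pi \<le> (4/5)\<^sup>2" using pi_approx(1) by (simp add: field_simps)
  qed simp_all
  have "has_bochner_integral lborel (\<lambda>x. a / 2 * (std_normal_density x * x)
      + a / 2 * (std_normal_density x * \<bar>x\<bar>) + a * a / 2 * std_normal_density x)
      (a / 2 * 0 + a / 2 * sqrt (2 / pi) + a * a / 2 * 1)"
    by (intro has_bochner_integral_add has_bochner_integral_mult_right one x1 abs1)
  then have G1: "has_bochner_integral lborel (\<lambda>x. std_normal_density x * (a * ((x + \<bar>x\<bar>) / 2 + a / 2)))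
      (a / 2 * sqrt (2 / pi) + a * a / 2)"
    by (simp add: field_simps)
  have "a * a \<le> a * (1/4)" "a / 2 * sqrt (2 / pi) \<le> a / 2 * (4/5)" using a m by (intro mult_left_mono; simp)+
  then have c1: "a / 2 * sqrt (2 / pi) + a * a / 2 \<le> 21/40 * a" by simp
  have P: "integrable M (\<lambda>\<omega>. if accept \<omega> then 0 else 1 :: real) \<and>
      (\<integral>\<omega>. (if accept \<omega> then 0 else 1) \<partial>M) \<le> a / 2 * sqrt (2 / pi) + a * a / 2"
    by (rule *[OF _ _ G1]) (auto simp: max_def)
  then show "integrable M (\<lambda>\<omega>. if accept \<omega> then 0 else 1 :: real)"
    "(\<integral>\<omega>. (if accept \<omega> then 0 else 1) \<partial>M) \<le> 21/40 * a"
    using c1 by auto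
  have "has_bochner_integral lborel (\<lambda>x. a * (std_normal_density x * x\<^sup>2)
      + a * a / 2 * (std_normal_density x * \<bar>x\<bar>)) (a * 1 + a * a / 2 * sqrt (2 / pi))"
    by (intro has_bochner_integral_add has_bochner_integral_mult_right x2 abs1)
  then have G2: "has_bochner_integral lborel (\<lambda>x. std_normal_density x * (a * x\<^sup>2 + a * a / 2 * \<bar>x\<bar>))
      (a + a * a / 2 * sqrt (2 / pi))"
    by (simp add: algebra_simps)
  have "a * a * sqrt (2 / pi) \<le> a * (1/4) * 1" using a m pi_gt3 by (intro mult_mono mult_left_mono) auto
  then have c2: "a + a * a / 2 * sqrt (2 / pi) \<le> 9/8 * a" by simp
  have "integrable M (\<lambda>\<omega>. if accept \<omega> then 0 else \<bar>s \<omega>\<bar>) \<and>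
      (\<integral>\<omega>. (if accept \<omega> then 0 else \<bar>s \<omega>\<bar>) \<partial>M) \<le> a + a * a / 2 * sqrt (2 / pi)"
  proof (rule *[OF _ _ G2])
    fix x :: real
    have "\<bar>x\<bar> * max 0 x \<le> x\<^sup>2" by (simp add: max_def power2_eq_square abs_if mult_nonneg_nonpos2)
    then have "a * (\<bar>x\<bar> * max 0 x) \<le> a * x\<^sup>2" using a by (intro mult_left_mono) auto
    then show "\<bar>x\<bar> * (a * (max 0 x + a / 2)) \<le> a * x\<^sup>2 + a * a / 2 * \<bar>x\<bar>"
      by (simp add: algebra_simps)
  qed auto
  then show "integrable M (\<lambda>\<omega>. if accept \<omega> then 0 else \<bar>s \<omega>\<bar>)"
    "(\<integral>\<omega>. (if accept \<omega> then 0 else \<bar>s \<omega>\<bar>) \<partial>M) \<le> 9/8 * a"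
    using c2 by auto
qed

end

context mean_field_hmc
begin

section \<open>The contraction of one coupled step\<close>

text \<open>Bound for a fixed outcome of the random variables. \<open>Q i\<close> indicates that the shift is rejected for particle \<open>i\<close>, and \<open>H i\<close> is
then the size of the reflected component. \<open>D i\<close> is the gain of a far or an accepted pair: a far pair contracts by the factor
\<open>1 - K T\<^sup>2 / 5\<close>, and an accepted shift brings the free motion to \<open>(1 - \<gamma> T) r\<close>, from which the forces take away
at most 9/100 of the gain. A rejection forfeits the gain and costs what the reflection lemma says. The bound is linear
in the random quantities, so that only their expectations are needed.\<close>

lemma coupled_distance_le:
  fixes \<gamma> Rt R1 :: real and x y \<xi> :: "real^'d^'n" and e :: "'n \<Rightarrow> real^'d" and u :: "'n \<Rightarrow> real"
  assumes Rt: "Rt = far_radius" and R1: "R1 = 5 / 4 * (Rt + 2 * T)"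
    and \<gamma>: "0 \<le> \<gamma>" "\<gamma> * T \<le> 1" "L * T\<^sup>2 \<le> 3/20 * (\<gamma> * T)"
    and e: "\<And>i. norm (e i) = 1"
  defines "r \<equiv> \<lambda>i. norm (x $ i - y $ i)"
    and "\<eta> \<equiv> coupled_velocity \<gamma> Rt e x y u \<xi>"
  defines "accept \<equiv> \<lambda>i. u i \<le> std_normal_density (e i \<bullet> \<xi> $ i + \<gamma> * r i) / std_normal_density (e i \<bullet> \<xi> $ i)"
  defines "Q \<equiv> \<lambda>i. if r i < Rt \<and> \<not> accept i then 1 else 0"
    and "H \<equiv> \<lambda>i. if r i < Rt \<and> \<not> accept i then \<bar>e i \<bullet> \<xi> $ i\<bar> else 0"
    and "D \<equiv> \<lambda>i. if r i < Rt then 91/100 * (\<gamma> * T * r i) * exp (- r i / T)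
                   else K * T\<^sup>2 / 5 * r i * exp (- R1 / T)"
  shows "particle_dist R1 T (hmc_position U h T x \<xi>) (hmc_position U h T y \<eta>)
    \<le> (\<Sum>i\<in>UNIV. dist_fun R1 T (r i) - D i + (D i + T * exp (- r i / T)) * Q i
           + 5/2 * T * exp (- R1 / T) * H i)
      + 5 * (\<epsilon> * Lt) * T\<^sup>2 * (\<Sum>i\<in>UNIV. r i + 2 * T * H i)"
proof -
  obtain q p q' p' where sol: "hmc_solution U h x \<xi> q p" "hmc_solution U h y \<eta> q' p'"
    using hmc_flow_exists by metis
  have r0: "0 \<le> r i" for i by (simp add: r_def)
  have H0: "0 \<le> H i" for i by (simp add: H_def)
  have L0: "0 < L" using K_le_L K by simp
  have Rt0: "0 \<le> Rt" unfolding Rt using R K L0 by simp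
  have R1_0: "0 \<le> R1" using Rt0 T by (simp add: R1)
  define Z where "Z i = r i + 2 * T * H i" for i
  have far: "\<xi> $ i - \<eta> $ i = 0" if "\<not> r i < Rt" for i
    using that by (simp add: \<eta>_def coupled_velocity_def r_def)
  have acc: "\<xi> $ i - \<eta> $ i = - (\<gamma> *\<^sub>R (x $ i - y $ i))" if "r i < Rt" "accept i" for i
    using that by (simp add: \<eta>_def coupled_velocity_def r_def accept_def)
  have rej: "\<xi> $ i - \<eta> $ i = (2 * (e i \<bullet> \<xi> $ i)) *\<^sub>R e i" if "r i < Rt" "\<not> accept i" for i
    using that by (simp add: \<eta>_def coupled_velocity_def r_def accept_def)
  have shrink: "norm (x $ i - y $ i + t *\<^sub>R (\<xi> $ i - \<eta> $ i)) = (1 - \<gamma> * t) * r i"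
    if "r i < Rt" "accept i" "t \<in> {0..T}" for i t
  proof -
    have "\<gamma> * t \<le> \<gamma> * T" using that \<gamma> by (intro mult_left_mono) auto
    moreover have "x $ i - y $ i + t *\<^sub>R (\<xi> $ i - \<eta> $ i) = (1 - \<gamma> * t) *\<^sub>R (x $ i - y $ i)"
      unfolding acc[OF that(1,2)] by (simp add: algebra_simps)
    ultimately show ?thesis using \<gamma> by (simp add: r_def)
  qed
  have Z: "norm (x $ i - y $ i + t *\<^sub>R (\<xi> $ i - \<eta> $ i)) \<le> Z i" if t: "t \<in> {0..T}" for i t
  proof -
    consider "\<not> r i < Rt" | "r i < Rt" "accept i" | "r i < Rt" "\<not> accept i" by blast
    then show ?thesis
    proof cases
      case 1
      then show ?thesis using far[OF 1] by (simp add: Z_def H_def r_def)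
    next
      case 2
      have "(1 - \<gamma> * t) * r i \<le> 1 * r i" using \<gamma> t r0 by (intro mult_right_mono) auto
      then show ?thesis using shrink[OF 2 t] 2 by (simp add: Z_def H_def)
    next
      case 3
      have "norm (t *\<^sub>R (\<xi> $ i - \<eta> $ i)) = t * (2 * \<bar>e i \<bullet> \<xi> $ i\<bar>)"
        unfolding rej[OF 3] using t e by (simp add: abs_mult)
      also have "\<dots> \<le> T * (2 * \<bar>e i \<bullet> \<xi> $ i\<bar>)" using t by (intro mult_right_mono) auto
      finally show ?thesis
        using norm_triangle_ineq[of "x $ i - y $ i" "t *\<^sub>R (\<xi> $ i - \<eta> $ i)"] 3
        by (simp add: Z_def H_def r_def)
    qed
  qed
  from trajectories_close[OF sol Z]
  obtain b where b0: "\<And>i. 0 \<le> b i"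
    and b: "(\<Sum>i\<in>UNIV. b i) \<le> 5 * (\<epsilon> * Lt) * T\<^sup>2 * (\<Sum>i\<in>UNIV. Z i)"
    and close: "\<And>i. norm (q T $ i - q' T $ i)
       \<le> norm (x $ i - y $ i + T *\<^sub>R (\<xi> $ i - \<eta> $ i)) + 20/37 * (L * T\<^sup>2) * Z i + b i"
    and contr: "\<And>i. \<xi> $ i = \<eta> $ i \<Longrightarrow> far_radius \<le> norm (x $ i - y $ i) \<Longrightarrow>
       norm (q T $ i - q' T $ i) \<le> (1 - K * T\<^sup>2 / 5) * norm (x $ i - y $ i) + b i" by metis
  have step: "dist_fun R1 T (norm (q T $ i - q' T $ i))
      \<le> dist_fun R1 T (r i) - D i + (D i + T * exp (- r i / T)) * Q i
           + 5/2 * T * exp (- R1 / T) * H i + b i" for i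
  proof -
    have reduce: "dist_fun R1 T (norm (q T $ i - q' T $ i)) \<le> dist_fun R1 T B + b i"
      if "norm (q T $ i - q' T $ i) \<le> B + b i" "0 \<le> B" for B
      using dist_fun_mono[OF T R1_0 norm_ge_zero that(1)] dist_fun_add_le[OF T R1_0 that(2) b0[of i]]
      by linarith
    consider "\<not> r i < Rt" | "r i < Rt" "accept i" | "r i < Rt" "\<not> accept i" by blast
    then show ?thesis
    proof cases
      case 1
      have kappa: "0 \<le> K * T\<^sup>2 / 5" "K * T\<^sup>2 / 5 \<le> 1"
      proof -
        have "K * T\<^sup>2 \<le> L * T\<^sup>2" by (intro mult_right_mono K_le_L) auto
        then show "K * T\<^sup>2 / 5 \<le> 1" using LT by simp
      qed (use K in simp)
      have "norm (q T $ i - q' T $ i) \<le> (1 - K * T\<^sup>2 / 5) * r i + b i"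
        using contr[of i] far[OF 1] 1 by (simp add: r_def Rt)
      moreover have "0 \<le> (1 - K * T\<^sup>2 / 5) * r i" using kappa r0 by simp
      ultimately have "dist_fun R1 T (norm (q T $ i - q' T $ i))
          \<le> dist_fun R1 T ((1 - K * T\<^sup>2 / 5) * r i) + b i" by (rule reduce)
      also have "\<dots> \<le> dist_fun R1 T (r i) - exp (- min R1 (r i) / T) * (K * T\<^sup>2 / 5 * r i) + b i"
        using dist_fun_contraction[OF T R1_0 r0 kappa] by simp
      also have "\<dots> \<le> dist_fun R1 T (r i) - exp (- R1 / T) * (K * T\<^sup>2 / 5 * r i) + b i"
      proof -
        have "exp (- R1 / T) \<le> exp (- min R1 (r i) / T)" using T by (simp add: divide_right_mono)
        then have "exp (- R1 / T) * (K * T\<^sup>2 / 5 * r i) \<le> exp (- min R1 (r i) / T) * (K * T\<^sup>2 / 5 * r i)"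
          using kappa r0 by (intro mult_right_mono mult_nonneg_nonneg) auto
        then show ?thesis by simp
      qed
      finally show ?thesis using 1 by (simp add: D_def Q_def H_def mult.commute)
    next
      case 2
      let ?\<beta> = "91/100 * (\<gamma> * T)"
      have \<beta>: "0 \<le> ?\<beta>" "?\<beta> \<le> 1" using \<gamma> T by auto
      have "norm (q T $ i - q' T $ i) \<le> (1 - \<gamma> * T) * r i + 20/37 * (L * T\<^sup>2) * r i + b i"
        using close[of i] shrink[OF 2, of T] T 2 by (simp add: Z_def H_def)
      also have "\<dots> \<le> (1 - ?\<beta>) * r i + b i"
      proof -
        have "20/37 * (L * T\<^sup>2) * r i \<le> 9/100 * (\<gamma> * T) * r i"
          using \<gamma>(3) mult_nonneg_nonneg[OF \<gamma>(1) less_imp_le[OF T]] r0 by (intro mult_right_mono) auto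
        then show ?thesis by (simp add: algebra_simps)
      qed
      finally have "dist_fun R1 T (norm (q T $ i - q' T $ i)) \<le> dist_fun R1 T ((1 - ?\<beta>) * r i) + b i"
        using \<beta> r0 by (intro reduce) auto
      also have "\<dots> \<le> dist_fun R1 T (r i) - exp (- min R1 (r i) / T) * (?\<beta> * r i) + b i"
        using dist_fun_contraction[OF T R1_0 r0 \<beta>] by simp
      also have "min R1 (r i) = r i" using 2 Rt0 T by (simp add: R1)
      finally show ?thesis using 2 by (simp add: D_def Q_def H_def mult.commute)
    next
      case 3
      have sH: "H i = \<bar>e i \<bullet> \<xi> $ i\<bar>" using 3 by (simp add: H_def)
      have "20/37 * (L * T\<^sup>2) * Z i \<le> 1/4 * Z i"
        using LT r0 H0 T by (intro mult_right_mono) (auto simp: Z_def)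
      moreover have "norm (x $ i - y $ i + T *\<^sub>R (\<xi> $ i - \<eta> $ i)) \<le> Z i" using Z[of T i] T by simp
      ultimately have "norm (q T $ i - q' T $ i) \<le> 5/4 * Z i + b i" using close[of i] by linarith
      then have "norm (q T $ i - q' T $ i) \<le> 5/4 * (r i + 2 * (T * H i)) + b i"
        by (simp add: Z_def mult.assoc)
      then have "dist_fun R1 T (norm (q T $ i - q' T $ i)) \<le> dist_fun R1 T (5/4 * (r i + 2 * (T * H i))) + b i"
        using r0 H0 T by (intro reduce) auto
      also have "\<dots> \<le> dist_fun R1 T (r i) + T * exp (- r i / T) + 5/2 * (T * exp (- R1 / T) * H i) + b i"
        using dist_fun_after_reflection[OF T Rt0 r0 _ H0 R1, of i] 3 by simp
      finally show ?thesis using 3 by (simp add: Q_def)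
    qed
  qed
  have "particle_dist R1 T (hmc_position U h T x \<xi>) (hmc_position U h T y \<eta>)
      = (\<Sum>i\<in>UNIV. dist_fun R1 T (norm (q T $ i - q' T $ i)))"
    unfolding particle_dist_def hmc_position_eq[OF sol(1)] hmc_position_eq[OF sol(2)] ..
  also have "\<dots> \<le> (\<Sum>i\<in>UNIV. dist_fun R1 T (r i) - D i + (D i + T * exp (- r i / T)) * Q i
           + 5/2 * T * exp (- R1 / T) * H i + b i)"
    by (intro sum_mono step)
  also have "\<dots> = (\<Sum>i\<in>UNIV. dist_fun R1 T (r i) - D i + (D i + T * exp (- r i / T)) * Q i
           + 5/2 * T * exp (- R1 / T) * H i) + (\<Sum>i\<in>UNIV. b i)"
    by (rule sum.distrib)
  finally show ?thesis using b by (simp add: Z_def)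
qed

end

text \<open>The balance for a near pair, with \<open>PQ\<close> the rejection probability and \<open>PH\<close> the expectation of the reflected component,
in units of \<open>g = \<gamma> T r E\<close>: the gain 91/100 is reduced by at most 0.12 for the gain lost in rejections, by 21/40 for
the cost of reaching \<open>R1\<close>, and by 0.24 for the distances beyond \<open>R1\<close>. What remains exceeds the
required rate because \<open>k\<close> is at most \<open>3/20 \<gamma> T\<close>; the interaction, entering through \<open>w\<close>, is smaller by orders of magnitude.\<close>

lemma drift_near:
  fixes \<gamma> T r k w D PQ PH E E0 E1 :: real
  assumes T: "0 < T" and r: "0 \<le> r" and \<gamma>: "0 \<le> \<gamma>" "\<gamma> * T \<le> 1" "\<gamma> * r \<le> 1/4"
    and k: "0 \<le> k" "k \<le> 3/20 * (\<gamma> * T)" and w: "0 \<le> w" "w \<le> k * E0 / 10^6"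
    and E: "0 < E0" "E0 \<le> E" "0 \<le> E1" "E1 \<le> 21/250 * E"
    and PQ: "PQ \<le> 21/40 * (\<gamma> * r)" and PH: "PH \<le> 9/8 * (\<gamma> * r)"
    and D: "D = 91/100 * (\<gamma> * T * r) * E"
  shows "- D + (D + T * E) * PQ + 5/2 * T * E1 * PH + 5 * w * (r + 2 * T * PH) \<le> - (k / 156 * E0) * r"
proof -
  define g where "g = \<gamma> * T * r * E"
  have E': "0 \<le> E" using E by simp
  have g0: "0 \<le> g" unfolding g_def using \<gamma> T r E' by simp
  have D': "D = 91/100 * g" by (simp add: D g_def)
  have "D * PQ \<le> D * (21/160)"
    using PQ \<gamma>(3) g0 by (intro mult_left_mono) (auto simp: D')
  moreover have "T * E * PQ \<le> T * E * (21/40 * (\<gamma> * r))"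
    using PQ T E' by (intro mult_left_mono) auto
  then have "T * E * PQ \<le> 21/40 * g" by (simp add: g_def algebra_simps)
  ultimately have 1: "(D + T * E) * PQ \<le> 91/100 * (21/160) * g + 21/40 * g"
    unfolding D' by (simp add: distrib_right)
  have "T * E1 * PH \<le> T * E1 * (9/8 * (\<gamma> * r))"
    using PH T E by (intro mult_left_mono) auto
  also have "\<dots> \<le> T * (21/250 * E) * (9/8 * (\<gamma> * r))"
    using T E \<gamma> r by (intro mult_right_mono mult_left_mono) auto
  also have "\<dots> = 21/250 * (9/8) * g" by (simp add: g_def)
  finally have 2: "T * E1 * PH \<le> 21/250 * (9/8) * g" .
  have "T * PH \<le> T * (9/8 * (\<gamma> * r))" using PH T by (intro mult_left_mono) auto
  also have "\<dots> = 9/8 * (\<gamma> * T * r)" by simp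
  also have "\<dots> \<le> 9/8 * (1 * r)" using \<gamma> r by (intro mult_left_mono mult_right_mono) auto
  finally have "r + 2 * T * PH \<le> 4 * r" using r by simp
  then have "w * (r + 2 * T * PH) \<le> w * (4 * r)" by (intro mult_left_mono w)
  also have "\<dots> \<le> (k * E0 / 10^6) * (4 * r)" using w r by (intro mult_right_mono) auto
  finally have 3: "w * (r + 2 * T * PH) \<le> 4 / 10^6 * (k * E0 * r)" by (simp add: mult_ac)
  have "k * E0 * r \<le> (3/20 * (\<gamma> * T)) * E * r"
    using k E \<gamma> T r by (intro mult_right_mono mult_mono) auto
  then have "k * E0 * r \<le> 3/20 * g" by (simp add: g_def algebra_simps)
  then show ?thesis using 1 2 3 g0 unfolding D' by simp
qed

text \<open>With \<open>p = Rt / T\<close>, the polynomial factor \<open>(1 + p)\<^sup>2 \<le> exp (2 p)\<close> is absorbed by \<open>exp (- 5 p)\<close>, so the interaction is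
negligible against the contraction rate, which carries only the factor \<open>exp (- 5/4 p)\<close>.\<close>

lemma weak_interaction_bound:
  fixes K T Rt w :: real
  assumes T: "0 < T" and Rt: "0 \<le> Rt" and K: "0 < K" and k: "K * T\<^sup>2 \<le> 3/20"
    and w: "w \<le> 1 / 2 * (K * (Rt + T) / (36 * 149))\<^sup>2 * exp (- 5 * (Rt / T))"
  shows "w * T\<^sup>2 \<le> K * T\<^sup>2 * exp (- (5 * Rt / (4 * T))) / 10^6" and "w \<le> K / 100"
proof -
  define p where "p = Rt / T"
  have p: "0 \<le> p" and RtT: "Rt + T = T * (1 + p)" using T Rt by (simp_all add: p_def field_simps)
  have "(1 + p)\<^sup>2 \<le> (exp p)\<^sup>2" using p exp_ge_add_one_self[of p] by (intro power_mono) auto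
  also have "\<dots> = exp (2 * p)" by (simp add: exp_double)
  finally have "(1 + p)\<^sup>2 * exp (- 5 * p) \<le> exp (2 * p) * exp (- 5 * p)" by (intro mult_right_mono) auto
  also have "\<dots> = exp (- 3 * p)" by (simp add: exp_add[symmetric])
  also have "\<dots> \<le> exp (- (5/4 * p))" using p by simp
  finally have pe: "(1 + p)\<^sup>2 * exp (- 5 * p) \<le> exp (- (5/4 * p))" .
  have "(K * (Rt + T))\<^sup>2 = K * (K * T\<^sup>2) * (1 + p)\<^sup>2"
    by (simp add: RtT power_mult_distrib power2_eq_square)
  then have "w \<le> K * (K * T\<^sup>2) * ((1 + p)\<^sup>2 * exp (- 5 * p)) / (2 * (36 * 149)\<^sup>2)"
    using w by (simp add: p_def power_divide)
  also have "\<dots> \<le> K * (3/20) * exp (- (5/4 * p)) / (2 * (36 * 149)\<^sup>2)"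
    using k K pe by (intro divide_right_mono mult_mono mult_left_mono) auto
  also have "\<dots> \<le> K * exp (- (5/4 * p)) / 10^6" using K by simp
  finally have w': "w \<le> K * exp (- (5/4 * p)) / 10^6" .
  then have "w * T\<^sup>2 \<le> K * exp (- (5/4 * p)) / 10^6 * T\<^sup>2" by (intro mult_right_mono) auto
  then show "w * T\<^sup>2 \<le> K * T\<^sup>2 * exp (- (5 * Rt / (4 * T))) / 10^6" by (simp add: p_def mult_ac)
  have "K * exp (- (5/4 * p)) \<le> K * 1" using p K by (intro mult_left_mono) auto
  moreover have "w * 10^6 \<le> K * exp (- (5/4 * p))" using w' by simp
  ultimately have "w * 10^6 \<le> K" by linarith
  then show "w \<le> K / 100" using K by simp
qed

lemma drift_far:
  fixes k r w D E0 E1 :: real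
  assumes k: "0 \<le> k" and r: "0 \<le> r" and w: "w \<le> k * E0 / 10^6"
    and E: "0 < E0" "E0 \<le> 27 * E1" and D: "D = k / 5 * r * E1"
  shows "- D + 5 * w * r \<le> - (k / 156 * E0) * r"
proof -
  define g where "g = k * E0 * r"
  have "k * r * E0 \<le> k * r * (27 * E1)" using k r E by (intro mult_left_mono) auto
  then have "g \<le> 135 * D" by (simp add: g_def D mult_ac)
  moreover have "w * r \<le> k * E0 / 10^6 * r" using w r by (intro mult_right_mono) auto
  then have "w * r \<le> g / 10^6" by (simp add: g_def)
  moreover have "0 \<le> g" using k r E by (simp add: g_def)
  ultimately show ?thesis by (simp add: g_def)
qed

text \<open>\<open>exp (- 5/2)\<close> is the ratio of \<open>exp (- R1 / T)\<close> to the exponential factor of the contraction rate, by the choice of \<open>R1\<close>.\<close>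

lemma exp_neg_five_half: "exp (- (5/2) :: real) \<le> 21/250" "1 \<le> 27 * exp (- (5/2) :: real)"
proof -
  have "(41/32)^10 \<le> (exp (1/4) :: real)^10"
    using exp_lower_Taylor_quadratic[of "1/4"] by (intro power_mono) (auto simp: power2_eq_square)
  also have "\<dots> = exp (5/2)" by (simp add: exp_of_nat_mult[symmetric])
  finally have "250/21 \<le> exp (5/2 :: real)" by (simp add: power_divide)
  then show "exp (- (5/2) :: real) \<le> 21/250" by (simp add: exp_minus field_simps)
  have "exp (5/2 :: real) \<le> exp 3" by simp
  also have "exp (3::real) = exp 1 ^ 3" by (simp add: exp_of_nat_mult[symmetric])
  also have "\<dots> \<le> 3 ^ 3" by (intro power_mono exp_le) simp
  finally show "1 \<le> 27 * exp (- (5/2) :: real)" by (simp add: exp_minus field_simps)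
qed

text \<open>The third term of the minimum amounts to \<open>L T Rt \<le> 3/80\<close>. Hence the forces contribute, during the time \<open>T\<close>, at most
a fixed fraction of the shift \<open>\<gamma> T\<close> also when \<open>\<gamma> = 1 / (4 Rt)\<close> is small.\<close>

lemma step_size_bounds:
  fixes L K Rt T h1 \<gamma> :: real
  assumes L: "0 \<le> L" and K: "0 < K" and T: "0 < T" and Rt: "0 \<le> Rt" and h1: "0 \<le> h1"
    and step: "L * (T + h1)\<^sup>2 \<le> 3 / 5 *
      (if Rt = 0 then min (1 / 4) (3 * K / (10 * L))
       else Min {1 / 4, 3 * K / (10 * L), 3 / (256 * (5 * L * Rt\<^sup>2))})"
    and \<gamma>: "\<gamma> = (if Rt = 0 then 1 / T else min (1 / T) (1 / Rt / 4))"
  shows "L * T\<^sup>2 \<le> 3/20" and "L\<^sup>2 * T\<^sup>2 \<le> 9/50 * K"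
    and "0 \<le> \<gamma>" and "\<gamma> * T \<le> 1" and "L * T\<^sup>2 \<le> 3/20 * (\<gamma> * T)"
    and "0 \<le> r \<Longrightarrow> r < Rt \<Longrightarrow> \<gamma> * r \<le> 1/4"
proof -
  have "L * T\<^sup>2 \<le> L * (T + h1)\<^sup>2" using L T h1 by (intro mult_left_mono power_mono) auto
  with step have le: "L * T\<^sup>2 \<le> 3 / 5 * (1/4)" "L * T\<^sup>2 \<le> 3 / 5 * (3 * K / (10 * L))"
    "Rt \<noteq> 0 \<Longrightarrow> L * T\<^sup>2 \<le> 3 / 5 * (3 / (256 * (5 * L * Rt\<^sup>2)))"
    by (auto split: if_splits)
  show LT: "L * T\<^sup>2 \<le> 3/20" using le(1) by simp
  show "L\<^sup>2 * T\<^sup>2 \<le> 9/50 * K"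
  proof (cases "L = 0")
    case False
    then have "L * (L * T\<^sup>2) \<le> L * (3 / 5 * (3 * K / (10 * L)))" using le(2) L by (intro mult_left_mono) auto
    then show ?thesis using False by (simp add: power2_eq_square)
  qed (use K in simp)
  show "0 \<le> \<gamma>" using T Rt by (simp add: \<gamma>)
  have "\<gamma> \<le> 1 / T" by (simp add: \<gamma>)
  then show "\<gamma> * T \<le> 1" using T by (simp add: field_simps)
  show "\<gamma> * r \<le> 1/4" if r: "0 \<le> r" "r < Rt"
  proof -
    have "\<gamma> * r \<le> 1 / Rt / 4 * Rt" using r T by (intro mult_mono) (auto simp: \<gamma>)
    then show ?thesis using r by simp
  qed
  show "L * T\<^sup>2 \<le> 3/20 * (\<gamma> * T)"
  proof (cases "Rt = 0 \<or> L = 0")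
    case True
    then show ?thesis using LT T Rt by (auto simp: \<gamma>)
  next
    case False
    then have Rt: "0 < Rt" and L: "0 < L" using Rt L by auto
    have "L * Rt\<^sup>2 * (L * T\<^sup>2) \<le> L * Rt\<^sup>2 * (3 / 5 * (3 / (256 * (5 * L * Rt\<^sup>2))))"
      using le(3) L Rt by (intro mult_left_mono) auto
    also have "\<dots> = (3/80)\<^sup>2" using L Rt by (simp add: power2_eq_square)
    finally have "(L * T * Rt)\<^sup>2 \<le> (3/80)\<^sup>2" by (simp add: power2_eq_square mult_ac)
    then have "L * T * Rt \<le> 3/80" by (rule power2_le_imp_le) simp
    then have "L * T\<^sup>2 \<le> 3/20 * (1 / Rt / 4 * T)"
      using mult_right_mono[of "L * T * Rt" "3/80" T] T Rt by (simp add: power2_eq_square field_simps)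
    moreover have "\<gamma> * T = 1 \<or> \<gamma> * T = 1 / Rt / 4 * T" using Rt T by (auto simp: \<gamma> min_def)
    ultimately show ?thesis using LT by auto
  qed
qed

lemma borel_measurable_vec_lambda:
  fixes f :: "'n::finite \<Rightarrow> 'a \<Rightarrow> 'b::euclidean_space"
  assumes [measurable]: "\<And>i. f i \<in> borel_measurable M"
  shows "(\<lambda>\<omega>. \<chi> i. f i \<omega>) \<in> borel_measurable M"
proof -
  have ax: "continuous_on UNIV (\<lambda>v::'b. axis i v :: 'b^'n)" for i
  proof -
    have "continuous_on UNIV (\<lambda>v::'b. if j = i then v else 0)" for j by (cases "j = i") auto
    then show ?thesis unfolding axis_def by (rule continuous_on_vec_lambda)
  qed
  have "(\<lambda>\<omega>. \<chi> i. f i \<omega>) = (\<lambda>\<omega>. \<Sum>i\<in>UNIV. axis i (f i \<omega>))"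
    by (auto simp: fun_eq_iff vec_eq_iff axis_def if_distrib sum.delta cong: if_cong)
  moreover have "(\<lambda>\<omega>. axis i (f i \<omega>) :: 'b^'n) \<in> borel_measurable M" for i
    using borel_measurable_continuous_onI[OF ax] by measurable
  ultimately show ?thesis by simp
qed

lemma borel_measurable_particle_dist:
  fixes X Y :: "'a \<Rightarrow> real^'d^'n"
  assumes T: "0 < T" and R1: "0 \<le> R1"
    and [measurable]: "X \<in> borel_measurable M" "Y \<in> borel_measurable M"
  shows "(\<lambda>\<omega>. particle_dist R1 T (X \<omega>) (Y \<omega>)) \<in> borel_measurable M"
proof -
  have lip: "dist_fun R1 T b - dist_fun R1 T a \<le> \<bar>b - a\<bar>" if "0 \<le> a" "0 \<le> b" for a b
  proof (cases "a \<le> b")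
    case True
    then show ?thesis using dist_fun_add_le[OF T R1 that(1), of "b - a"] by simp
  next
    case False
    then show ?thesis using dist_fun_mono[OF T R1 that(2), of a] by simp
  qed
  have "1-lipschitz_on {0..} (dist_fun R1 T)"
  proof (rule lipschitz_onI)
    fix a b :: real assume "a \<in> {0..}" "b \<in> {0..}"
    then show "dist (dist_fun R1 T a) (dist_fun R1 T b) \<le> 1 * dist a b"
      using lip[of a b] lip[of b a] by (simp add: dist_real_def)
  qed simp
  then have "continuous_on {0..} (dist_fun R1 T)" by (rule lipschitz_on_continuous_on)
  then have "continuous_on UNIV (\<lambda>v::real^'d. dist_fun R1 T (norm v))"
    by (rule continuous_on_compose2) (auto intro!: continuous_intros)
  note [measurable] = borel_measurable_continuous_onI[OF this]
  have [measurable]: "(\<lambda>\<omega>. X \<omega> $ i) \<in> borel_measurable M" "(\<lambda>\<omega>. Y \<omega> $ i) \<in> borel_measurable M" for i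
    by (auto intro!: borel_measurable_continuous_on[where f = "\<lambda>v. v $ i"] continuous_intros)
  show ?thesis unfolding particle_dist_def by measurable
qed

lemma borel_measurable_coupled_velocity:
  fixes \<xi> :: "'a \<Rightarrow> real^'d^'n"
  assumes [measurable]: "\<xi> \<in> borel_measurable M" "\<And>i. u i \<in> borel_measurable M"
  shows "(\<lambda>\<omega>. coupled_velocity \<gamma> Rt e x y (\<lambda>i. u i \<omega>) (\<xi> \<omega>)) \<in> borel_measurable M"
proof -
  have [measurable]: "(\<lambda>\<omega>. \<xi> \<omega> $ i) \<in> borel_measurable M" for i
    by (auto intro!: borel_measurable_continuous_on[where f = "\<lambda>v. v $ i"] continuous_intros)
  show ?thesis unfolding coupled_velocity_def
    by (intro borel_measurable_vec_lambda) measurable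
qed

lemma (in prob_space) indep_projection_component:
  fixes \<xi> :: "'a \<Rightarrow> 'b::topological_space" and u :: "'n \<Rightarrow> 'a \<Rightarrow> real" and s :: "'b \<Rightarrow> real"
  assumes [measurable]: "\<xi> \<in> borel_measurable M" "u i \<in> borel_measurable M" "s \<in> borel_measurable borel"
    and indep: "indep_set (sets (vimage_algebra (space M) \<xi> borel))
      (sets (vimage_algebra (space M) (\<lambda>\<omega> i. u i \<omega>) (Pi\<^sub>M UNIV (\<lambda>_. borel))))"
  shows "indep_var borel (\<lambda>\<omega>. s (\<xi> \<omega>)) borel (u i)"
  unfolding indep_var_eq
proof (intro conjI)
  let ?A = "{(\<lambda>\<omega>. s (\<xi> \<omega>)) -` A \<inter> space M | A. A \<in> sets borel}" and ?B = "{u i -` B \<inter> space M | B. B \<in> sets borel}"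
  have "?A \<subseteq> sets (vimage_algebra (space M) \<xi> borel)"
  proof safe
    fix A :: "real set" assume "A \<in> sets borel"
    then have "s -` A \<inter> space borel \<in> sets borel" by measurable
    then have "\<xi> -` (s -` A \<inter> space borel) \<inter> space M \<in> sets (vimage_algebra (space M) \<xi> borel)"
      by (rule in_vimage_algebra)
    then show "(\<lambda>\<omega>. s (\<xi> \<omega>)) -` A \<inter> space M \<in> sets (vimage_algebra (space M) \<xi> borel)"
      by (simp add: vimage_def)
  qed
  then have A: "sigma_sets (space M) ?A \<subseteq> sets (vimage_algebra (space M) \<xi> borel)"
    using sets.sigma_sets_subset[of ?A "vimage_algebra (space M) \<xi> borel"] by simp
  have "?B \<subseteq> sets (vimage_algebra (space M) (\<lambda>\<omega> i. u i \<omega>) (Pi\<^sub>M UNIV (\<lambda>_. borel)))"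
  proof safe
    fix B :: "real set" assume B: "B \<in> sets borel"
    have "(\<lambda>f. f i) -` B \<inter> space (Pi\<^sub>M UNIV (\<lambda>_. borel)) \<in> sets (Pi\<^sub>M UNIV (\<lambda>_. borel))"
      by (rule measurable_sets[OF measurable_component_singleton[of i UNIV "\<lambda>_. borel"] B]) simp
    then have "(\<lambda>\<omega> i. u i \<omega>) -` ((\<lambda>f. f i) -` B \<inter> space (Pi\<^sub>M UNIV (\<lambda>_. borel))) \<inter> space M
        \<in> sets (vimage_algebra (space M) (\<lambda>\<omega> i. u i \<omega>) (Pi\<^sub>M UNIV (\<lambda>_. borel)))"
      by (rule in_vimage_algebra)
    then show "u i -` B \<inter> space M \<in> sets (vimage_algebra (space M) (\<lambda>\<omega> i. u i \<omega>) (Pi\<^sub>M UNIV (\<lambda>_. borel)))"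
      by (simp add: vimage_def space_PiM)
  qed
  then have B: "sigma_sets (space M) ?B \<subseteq> sets (vimage_algebra (space M) (\<lambda>\<omega> i. u i \<omega>) (Pi\<^sub>M UNIV (\<lambda>_. borel)))"
    using sets.sigma_sets_subset[of ?B "vimage_algebra (space M) (\<lambda>\<omega> i. u i \<omega>) (Pi\<^sub>M UNIV (\<lambda>_. borel))"] by simp
  show "indep_set (sigma_sets (space M) ?A) (sigma_sets (space M) ?B)"
    using indep A B unfolding indep_sets2_eq by (meson subset_iff)
qed measurable

theorem theorem3:
  fixes V W :: "real^'d \<Rightarrow> real"
    and U :: "real^'d^'n \<Rightarrow> real"
    and L K R Lt T Rt \<gamma> R1 h1 \<epsilon> c h :: real
    and x y :: "real^'d^'n"
    and e :: "'n \<Rightarrow> real^'d"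
    and M :: "'w measure"
    and \<xi> :: "'w \<Rightarrow> real^'d^'n"
    and u :: "'n \<Rightarrow> 'w \<Rightarrow> real"
  assumes "C2 V" and "C2 W" and "\<epsilon> \<ge> 0"
    and "U = mean_field_potential V W \<epsilon>"
    and "(\<integral>\<^sup>+ z. ennreal (exp (- U z)) \<partial>lborel) < \<infinity>"
    and "V 0 = 0" and "\<And>a. V a \<ge> 0"
    and "bdd_above (range (\<lambda>a. norm (hessian V a)))" and "L = (SUP a. norm (hessian V a))"
    and "K > 0" and "R \<ge> 0"
    and "\<And>a b. norm (a - b) \<ge> R \<Longrightarrow> (a - b) \<bullet> (grad V a - grad V b) \<ge> K * (norm (a - b))\<^sup>2"
    and "bdd_above (range (\<lambda>a. norm (hessian W a)))" and "Lt = (SUP a. norm (hessian W a))"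
    and "T > 0"
    and "Rt = 8 * R * sqrt ((L + K) / K)"
    and "\<gamma> = (if Rt = 0 then 1 / T else min (1 / T) (1 / Rt / 4))"
    and "R1 = 5 / 4 * (Rt + 2 * T)"
    and "h1 \<ge> 0"
    and "L * (T + h1)\<^sup>2 \<le> 3 / 5 *
      (if Rt = 0 then min (1 / 4) (3 * K / (10 * L))
       else Min {1 / 4, 3 * K / (10 * L), 3 / (256 * (5 * L * Rt\<^sup>2))})"
    and "h1 \<le> K * T / (525 * L + 235 * K)"
    and "\<epsilon> * Lt < min (K / 6)
      (1 / 2 * (K * (Rt + T) / (36 * 149))\<^sup>2 * exp (- 5 * (Rt / T)))"
    and "c = 1 / 156 * K * T\<^sup>2 * exp (- (5 * Rt / (4 * T)))"
    and "0 \<le> h" and "h \<le> h1" and "h = 0 \<or> T / h \<in> \<nat>"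
    and "\<And>i. norm (e i) = 1"
    and "\<And>i. x $ i \<noteq> y $ i \<Longrightarrow> e i = (x $ i - y $ i) /\<^sub>R norm (x $ i - y $ i)"
    and "prob_space M"
    and "distributed M lborel \<xi>
      (\<lambda>v. ennreal (\<Prod>i\<in>UNIV. \<Prod>k\<in>UNIV. std_normal_density (v $ i $ k)))"
    and "\<And>i. distributed M lborel (u i) (indicator {0..1})"
    and "prob_space.indep_vars M (\<lambda>_. borel) u UNIV"
    and "prob_space.indep_set M (sets (vimage_algebra (space M) \<xi> borel))
      (sets (vimage_algebra (space M) (\<lambda>\<omega> i. u i \<omega>) (Pi\<^sub>M UNIV (\<lambda>_. borel))))"
  defines "X \<equiv> \<lambda>\<omega>. hmc_position U h T x (\<xi> \<omega>)"
    and "Y \<equiv> \<lambda>\<omega>. hmc_position U h T y (coupled_velocity \<gamma> Rt e x y (\<lambda>i. u i \<omega>) (\<xi> \<omega>))"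
  shows "integrable M (\<lambda>\<omega>. particle_dist R1 T (X \<omega>) (Y \<omega>)) \<and>
    (\<integral>\<omega>. particle_dist R1 T (X \<omega>) (Y \<omega>) \<partial>M) \<le> (1 - c) * particle_dist R1 T x y"
proof -
  interpret prob_space M by fact
  have C2V: "C2 V" and C2W: "C2 W" and eps: "\<epsilon> \<ge> 0" and U: "U = mean_field_potential V W \<epsilon>"
    and bddV: "bdd_above (range (\<lambda>a. norm (hessian V a)))" and Ldef: "L = (SUP a. norm (hessian V a))"
    and K: "K > 0" and R: "R \<ge> 0"
    and diss: "\<And>a b. norm (a - b) \<ge> R \<Longrightarrow> (a - b) \<bullet> (grad V a - grad V b) \<ge> K * (norm (a - b))\<^sup>2"
    and bddW: "bdd_above (range (\<lambda>a. norm (hessian W a)))" and Ltdef: "Lt = (SUP a. norm (hessian W a))"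
    and T: "T > 0" and Rt: "Rt = 8 * R * sqrt ((L + K) / K)"
    and R1: "R1 = 5 / 4 * (Rt + 2 * T)" and e: "\<And>i. norm (e i) = 1"
    and \<xi>: "distributed M lborel \<xi> (\<lambda>v. ennreal (\<Prod>i\<in>UNIV. \<Prod>k\<in>UNIV. std_normal_density (v $ i $ k)))"
    and u: "\<And>i. distributed M lborel (u i) (indicator {0..1})"
    and indep: "indep_set (sets (vimage_algebra (space M) \<xi> borel))
      (sets (vimage_algebra (space M) (\<lambda>\<omega> i. u i \<omega>) (Pi\<^sub>M UNIV (\<lambda>_. borel))))"
    and cdef: "c = 1 / 156 * K * T\<^sup>2 * exp (- (5 * Rt / (4 * T)))"
    by fact+
  have L0: "0 \<le> L" unfolding Ldef using order.trans[OF norm_ge_zero cSUP_upper[OF UNIV_I bddV]] .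
  have Rt0: "0 \<le> Rt" unfolding Rt using R K L0 by simp
  note step = step_size_bounds[OF L0 K T Rt0 \<open>h1 \<ge> 0\<close>
      \<open>L * (T + h1)\<^sup>2 \<le> 3 / 5 * (if Rt = 0 then min (1 / 4) (3 * K / (10 * L))
       else Min {1 / 4, 3 * K / (10 * L), 3 / (256 * (5 * L * Rt\<^sup>2))})\<close>
      \<open>\<gamma> = (if Rt = 0 then 1 / T else min (1 / T) (1 / Rt / 4))\<close>]
  have lipV: "norm (grad V a - grad V b) \<le> L * norm (a - b)" for a b
    unfolding Ldef by (rule grad_lipschitz[OF C2V bddV])
  have KL: "K \<le> L" using lipV diss by (rule dissipativity_le_lipschitz)
  define k E0 E1 w where "k = K * T\<^sup>2" and "E0 = exp (- (5 * Rt / (4 * T)))"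
    and "E1 = exp (- R1 / T)" and "w = \<epsilon> * Lt * T\<^sup>2"
  have k_le: "k \<le> L * T\<^sup>2" unfolding k_def by (intro mult_right_mono KL) auto
  have k0: "0 \<le> k" using K by (simp add: k_def)
  have weak_le: "\<epsilon> * Lt \<le> 1 / 2 * (K * (Rt + T) / (36 * 149))\<^sup>2 * exp (- 5 * (Rt / T))"
    using \<open>\<epsilon> * Lt < min (K / 6) (1 / 2 * (K * (Rt + T) / (36 * 149))\<^sup>2 * exp (- 5 * (Rt / T)))\<close> by simp
  note weak = weak_interaction_bound[OF T Rt0 K _ weak_le]
  have kT: "K * T\<^sup>2 \<le> 3/20" using k_le step(1) by (simp add: k_def)
  interpret flow: mean_field_hmc V W U \<epsilon> L Lt K R T h
  proof
    show "norm (grad W a - grad W b) \<le> Lt * norm (a - b)" for a b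
      unfolding Ltdef by (rule grad_lipschitz[OF C2W bddW])
    show "\<epsilon> * Lt \<le> K / 100" using weak(2)[OF kT] .
  qed (use C2V C2W eps U K R T lipV diss step(1,2) \<open>0 \<le> h\<close> \<open>h = 0 \<or> T / h \<in> \<nat>\<close> in auto)
  have w: "0 \<le> w" "w \<le> k * E0 / 10^6"
    using weak(1)[OF kT] eps flow.Lt_nonneg by (simp_all add: w_def k_def E0_def)
  have R1_0: "0 \<le> R1" using Rt0 T by (simp add: R1)
  have E1: "E1 = E0 * exp (- (5/2))"
    using T by (simp add: E1_def E0_def R1 exp_add[symmetric] field_simps)
  have E0_pos: "0 < E0" by (simp add: E0_def)
  have E0_le: "E0 \<le> 27 * E1"
    using mult_left_mono[OF exp_neg_five_half(2), of E0] E0_pos by (simp add: E1)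

  \<comment> \<open>The data of the linear pointwise bound \<open>G\<close>.\<close>
  define r where "r i = norm (x $ i - y $ i)" for i
  define s where "s i \<omega> = e i \<bullet> \<xi> \<omega> $ i" for i \<omega>
  define accept where "accept i \<omega> \<longleftrightarrow>
    u i \<omega> \<le> std_normal_density (s i \<omega> + \<gamma> * r i) / std_normal_density (s i \<omega>)" for i \<omega>
  define Q :: "'n \<Rightarrow> 'w \<Rightarrow> real" where "Q i \<omega> = (if r i < Rt \<and> \<not> accept i \<omega> then 1 else 0)" for i \<omega>
  define H where "H i \<omega> = (if r i < Rt \<and> \<not> accept i \<omega> then \<bar>s i \<omega>\<bar> else 0)" for i \<omega>
  define D where "D i = (if r i < Rt then 91/100 * (\<gamma> * T * r i) * exp (- r i / T)
                   else K * T\<^sup>2 / 5 * r i * E1)" for i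
  define G where "G \<omega> = (\<Sum>i\<in>UNIV. dist_fun R1 T (r i) - D i + (D i + T * exp (- r i / T)) * Q i \<omega>
           + 5/2 * T * E1 * H i \<omega>) + 5 * w * (\<Sum>i\<in>UNIV. r i + 2 * T * H i \<omega>)" for \<omega>
  have r0: "0 \<le> r i" for i by (simp add: r_def)
  have pointwise: "particle_dist R1 T (X \<omega>) (Y \<omega>) \<le> G \<omega>" for \<omega>
    using flow.coupled_distance_le[where x = x and y = y and u = "\<lambda>i. u i \<omega>" and \<xi> = "\<xi> \<omega>",
        OF Rt R1 step(3,4,5) e]
    unfolding X_def Y_def G_def w_def Q_def H_def D_def E1_def accept_def s_def r_def
    by (simp add: mult.assoc)

  have [measurable]: "\<xi> \<in> borel_measurable M" "\<And>i. u i \<in> borel_measurable M"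
    using distributed_measurable[OF \<xi>] distributed_measurable[OF u] by simp_all
  have s_normal: "distributed M lborel (s i) std_normal_density" for i
  proof -
    have "distributed M lborel \<xi> (\<lambda>v. ennreal (\<Prod>b\<in>Basis. std_normal_density (v \<bullet> b)))"
      using \<xi> by (simp add: prod_Basis_vec)
    from std_normal_projection[OF this, of "axis i (e i)"] e[of i]
    show ?thesis by (simp add: s_def[abs_def] inner_axis' norm_eq_1 inner_axis_axis)
  qed
  have s_indep: "indep_var borel (s i) borel (u i)" for i
    unfolding s_def[abs_def]
    by (rule indep_projection_component[OF _ _ _ indep, where s = "\<lambda>v. e i \<bullet> v $ i"])
       (auto intro!: borel_measurable_continuous_onI continuous_intros)
  have Q: "integrable M (Q i) \<and> integrable M (H i) \<and>
      (r i < Rt \<longrightarrow> expectation (Q i) \<le> 21/40 * (\<gamma> * r i) \<and> expectation (H i) \<le> 9/8 * (\<gamma> * r i))" for i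
  proof (cases "r i < Rt")
    case True
    have a: "0 \<le> \<gamma> * r i" "\<gamma> * r i \<le> 1/4" using step(3) step(6)[OF r0 True] r0 by auto
    have "Q i = (\<lambda>\<omega>. if accept i \<omega> then 0 else 1)" "H i = (\<lambda>\<omega>. if accept i \<omega> then 0 else \<bar>s i \<omega>\<bar>)"
      using True by (auto simp: Q_def H_def)
    then show ?thesis
      using rejection_bounds[OF s_normal[of i] u[of i] s_indep[of i] a, folded accept_def] by auto
  next
    case False
    then show ?thesis by (simp add: Q_def[abs_def] H_def[abs_def])
  qed
  have G_int: "integrable M G"
    unfolding G_def[abs_def] using Q
    by (intro Bochner_Integration.integrable_add Bochner_Integration.integrable_sum
        integrable_mult_right integrable_const) auto
  have EG: "expectation G = (\<Sum>i\<in>UNIV. dist_fun R1 T (r i) + (- D i + (D i + T * exp (- r i / T)) * expectation (Q i)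
           + 5/2 * T * E1 * expectation (H i) + 5 * w * (r i + 2 * T * expectation (H i))))"
    unfolding G_def[abs_def] using Q
    by (simp add: prob_space sum.distrib sum_subtractf sum_negf sum_distrib_left sum_distrib_right algebra_simps)

  \<comment> \<open>The expected change of particle \<open>i\<close>, with its share of the interaction, is at most \<open>- c\<close> times its distance.\<close>
  have drift: "- D i + (D i + T * exp (- r i / T)) * expectation (Q i)
           + 5/2 * T * E1 * expectation (H i) + 5 * w * (r i + 2 * T * expectation (H i))
      \<le> - (k / 156 * E0) * r i" for i
  proof (cases "r i < Rt")
    case True
    have "E0 \<le> exp (- r i / T)"
      unfolding E0_def using True T Rt0 by (simp add: field_simps)
    moreover have "E1 \<le> 21/250 * exp (- r i / T)"
    proof -
      have "E1 \<le> E0 * (21/250)" unfolding E1 using exp_neg_five_half(1) E0_pos by (intro mult_left_mono) auto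
      with \<open>E0 \<le> exp (- r i / T)\<close> show ?thesis by simp
    qed
    ultimately show ?thesis
      using Q[of i] True k_le step(5)
      by (intro drift_near[OF T r0 step(3,4) step(6)[OF r0 True] k0 _ w E0_pos])
         (auto simp: D_def E1_def)
  next
    case False
    then have "Q i = (\<lambda>_. 0)" "H i = (\<lambda>_. 0)" by (auto simp: Q_def H_def)
    then show ?thesis
      using drift_far[OF k0 r0 w(2) E0_pos E0_le, of "D i" i] False by (simp add: D_def k_def)
  qed
  have "expectation G \<le> (\<Sum>i\<in>UNIV. (1 - c) * dist_fun R1 T (r i))"
    unfolding EG
  proof (rule sum_mono)
    fix i
    have c: "c = k / 156 * E0" by (simp add: cdef k_def E0_def)
    have "k / 156 * E0 * dist_fun R1 T (r i) \<le> k / 156 * E0 * r i"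
      using k0 E0_pos dist_fun_le_id[OF T R1_0 r0] by (intro mult_left_mono) auto
    then have "dist_fun R1 T (r i) + - (k / 156 * E0) * r i \<le> (1 - c) * dist_fun R1 T (r i)"
      by (simp add: c left_diff_distrib)
    with add_left_mono[OF drift[of i], of "dist_fun R1 T (r i)"]
    show "dist_fun R1 T (r i) + (- D i + (D i + T * exp (- r i / T)) * expectation (Q i)
           + 5/2 * T * E1 * expectation (H i) + 5 * w * (r i + 2 * T * expectation (H i)))
        \<le> (1 - c) * dist_fun R1 T (r i)"
      by (rule order.trans)
  qed
  also have "\<dots> = (1 - c) * particle_dist R1 T x y"
    by (simp add: particle_dist_def r_def sum_distrib_left)
  finally have EG_le: "expectation G \<le> (1 - c) * particle_dist R1 T x y" .

  have [measurable]: "hmc_position U h T x' \<in> borel_measurable borel" for x'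
    by (rule borel_measurable_continuous_onI[OF flow.continuous_hmc_position])
  have "X \<in> borel_measurable M" unfolding X_def by measurable
  moreover have "Y \<in> borel_measurable M"
  proof -
    note [measurable] = borel_measurable_coupled_velocity[of \<xi> M u]
    show ?thesis unfolding Y_def by measurable
  qed
  ultimately have meas: "(\<lambda>\<omega>. particle_dist R1 T (X \<omega>) (Y \<omega>)) \<in> borel_measurable M"
    by (rule borel_measurable_particle_dist[OF T R1_0])
  have "0 \<le> particle_dist R1 T (X \<omega>) (Y \<omega>)" for \<omega>
    unfolding particle_dist_def by (intro sum_nonneg dist_fun_nonneg[OF T R1_0]) simp
  then have "norm (particle_dist R1 T (X \<omega>) (Y \<omega>)) \<le> norm (G \<omega>)" for \<omega>
    using pointwise[of \<omega>] by (simp add: abs_of_nonneg order.trans[OF _ abs_ge_self])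
  then have int: "integrable M (\<lambda>\<omega>. particle_dist R1 T (X \<omega>) (Y \<omega>))"
    by (intro Bochner_Integration.integrable_bound[OF G_int meas]) simp
  moreover have "expectation (\<lambda>\<omega>. particle_dist R1 T (X \<omega>) (Y \<omega>)) \<le> expectation G"
    by (intro integral_mono int G_int pointwise)
  ultimately show ?thesis using EG_le by simp
qed

end
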